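(* Consider the canonical action of $\mathrm{PSL}_2(\mathbb Z)$ on the circle $S^1=\mathbb P(\mathbb R^2)$. In the standard affine chart, its only non-expandable points are $0$ and $\infty$. Both of them are isolated fixed points of certain elements (namely, of $x\mapsto x/(x+1)$ and $x\mapsto x+1$, respectively), and therefore the action satisfies property $(\star)$. On the other hand, the Lyapunov expansion exponent of the action equals zero, i.e. $\lambda_{exp}(x;\mathcal F)=0$ for Lebesgue-almost every $x\in S^1$, where $\mathcal F$ is a finite set generating $\mathrm{PSL}_2(\mathbb Z)$ as a semigroup.
   Context: A point of $\mathbb P(\mathbb R^2)$ is the line spanned by a nonzero vector $(u,v)=(\cos\theta,\sin\theta)$; the circle is parametrized by the angle $\theta$ modulo $\pi$, and the derivative $g'$ of an element is taken with respect to the coordinate (metric) $\theta$. The affine chart is $x=u/v=\cot\theta\in\mathbb R\cup\{\infty\}$, in which $\pm\begin{pmatrix}a&b\\c&d\end{pmatrix}$ acts by $x\mapsto\frac{ax+b}{cx+d}$; the points $0$ and $\infty$ are $(0:1)$ and $(1:0)$. For a group $G$ of circle diffeomorphisms, a point $x$ is non-expandable if $g'(x)\le1$ for all $g\in G$; $\mathrm{NE}(G)$ is the set of such points. Property $(\star)$: $G$ acts minimally (all orbits are dense) and for every $x\in\mathrm{NE}(G)$ there are $g_+,g_-\in G$ fixing $x$ such that, for some $\varepsilon>0$, $g_+$ has no other fixed point in $(x,x+\varepsilon)$ and $g_-$ none in $(x-\varepsilon,x)$. If $\mathcal F$ is a finite set generating $G$ as a semigroup and $\|\cdot\|_{\mathcal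 F}$ is the word length, the Lyapunov expansion exponent at $x$ is $\lambda_{exp}(x;\mathcal F)=\limsup_{n\to\infty}\max_{\|g\|_{\mathcal F}\le n}\frac1n\log g'(x)$. Whether it is zero or positive does not depend on the choice of $\mathcal F$. *)

theory Defs
  imports "HOL-Analysis.Analysis" "HOL-Algebra.Group_Action"
begin

section \<open>The circle as the projective line\<close>

typedef rp1 = "{L :: (real^2) set. \<exists>v. v \<noteq> 0 \<and> L = span {v}}"
  by (rule exI[of _ "span {axis 1 1}"]) (auto intro!: exI[of _ "axis 1 1 :: real^2"] simp: axis_eq_0_iff)

definition line_through :: "real^2 \<Rightarrow> rp1" where
  "line_through v = Abs_rp1 (span {v})"

definition circle_pt :: "real \<Rightarrow> rp1" where
  "circle_pt \<theta> = line_through (vector [cos \<theta>, sin \<theta>])"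

text \<open>The circle carries the quotient topology of the real line under \<^const>\<open>circle_pt\<close>.\<close>

instantiation rp1 :: topological_space
begin

definition open_rp1 :: "rp1 set \<Rightarrow> bool" where
  "open_rp1 U \<longleftrightarrow> open (circle_pt -` U)"

instance
  by standard (auto simp: open_rp1_def vimage_Int vimage_Union)

end

text \<open>Normalized to have total mass \<open>\<pi>\<close>.\<close>

definition circle_lebesgue :: "rp1 measure" where
  "circle_lebesgue = distr (lebesgue_on {0..<pi}) borel circle_pt"

text \<open>The inverse of the affine chart \<open>(u : v) \<mapsto> u / v\<close>, and the point at infinity.\<close>

definition affine_pt :: "real \<Rightarrow> rp1" where
  "affine_pt x = line_through (vector [x, 1])"

definition infinity_pt :: rp1 where
  "infinity_pt = line_through (vector [1, 0])"


section \<open>Actions on the circle\<close>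

text \<open>The derivative with respect to the angle, read off from any local lift \<open>h\<close> of \<open>f\<close> to the
  real line; it is independent of the lift by \<open>has_circle_deriv_unique\<close> below.\<close>

definition has_circle_deriv :: "(rp1 \<Rightarrow> rp1) \<Rightarrow> real \<Rightarrow> rp1 \<Rightarrow> bool" where
  "has_circle_deriv f D x \<longleftrightarrow>
     (\<exists>\<theta> h. x = circle_pt \<theta> \<and> (\<forall>\<^sub>F t in nhds \<theta>. f (circle_pt t) = circle_pt (h t)) \<and>
            (h has_real_derivative D) (at \<theta>))"

definition circle_deriv :: "(rp1 \<Rightarrow> rp1) \<Rightarrow> rp1 \<Rightarrow> real" where
  "circle_deriv f x = (THE D. has_circle_deriv f D x)"

definition NE :: "('g, 'm) monoid_scheme \<Rightarrow> ('g \<Rightarrow> rp1 \<Rightarrow> rp1) \<Rightarrow> rp1 set" where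
  "NE G \<phi> = {x. \<forall>g\<in>carrier G. circle_deriv (\<phi> g) x \<le> 1}"

definition minimal_action :: "('g, 'm) monoid_scheme \<Rightarrow> ('g \<Rightarrow> rp1 \<Rightarrow> rp1) \<Rightarrow> bool" where
  "minimal_action G \<phi> \<longleftrightarrow> (\<forall>x. closure (orbit G \<phi> x) = UNIV)"

definition isolated_fixed_point :: "(rp1 \<Rightarrow> rp1) \<Rightarrow> rp1 \<Rightarrow> bool" where
  "isolated_fixed_point f x \<longleftrightarrow> f x = x \<and> (\<exists>U. open U \<and> x \<in> U \<and> (\<forall>y\<in>U. f y = y \<longrightarrow> y = x))"

text \<open>The interval \<open>(x, x + \<epsilon>)\<close> of the circle, where \<open>x = circle_pt \<theta>\<close>, consists of the points
  \<open>circle_pt t\<close> with \<open>\<theta> < t < \<theta> + \<epsilon>\<close>.\<close>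

definition property_star :: "('g, 'm) monoid_scheme \<Rightarrow> ('g \<Rightarrow> rp1 \<Rightarrow> rp1) \<Rightarrow> bool" where
  "property_star G \<phi> \<longleftrightarrow> minimal_action G \<phi> \<and>
     (\<forall>\<theta>. circle_pt \<theta> \<in> NE G \<phi> \<longrightarrow>
        (\<exists>gp\<in>carrier G. \<exists>gm\<in>carrier G.
           \<phi> gp (circle_pt \<theta>) = circle_pt \<theta> \<and> \<phi> gm (circle_pt \<theta>) = circle_pt \<theta> \<and>
           (\<exists>\<epsilon>>0. (\<forall>t\<in>{\<theta><..<\<theta> + \<epsilon>}. \<phi> gp (circle_pt t) \<noteq> circle_pt t) \<and>
                   (\<forall>t\<in>{\<theta> - \<epsilon><..<\<theta>}. \<phi> gm (circle_pt t) \<noteq> circle_pt t))))"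


section \<open>Word length and the Lyapunov expansion exponent\<close>

definition word_prod :: "('g, 'm) monoid_scheme \<Rightarrow> 'g list \<Rightarrow> 'g" where
  "word_prod G ws = foldr (monoid.mult G) ws (one G)"

definition generates_semigroup :: "('g, 'm) monoid_scheme \<Rightarrow> 'g set \<Rightarrow> bool" where
  "generates_semigroup G F \<longleftrightarrow> F \<subseteq> carrier G \<and>
     (\<forall>g\<in>carrier G. \<exists>ws. ws \<noteq> [] \<and> set ws \<subseteq> F \<and> word_prod G ws = g)"

text \<open>The identity is the empty word, of length 0.\<close>

definition word_length :: "('g, 'm) monoid_scheme \<Rightarrow> 'g set \<Rightarrow> 'g \<Rightarrow> nat" where
  "word_length G F g = (LEAST n. \<exists>ws. set ws \<subseteq> F \<and> length ws = n \<and> word_prod G ws = g)"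

definition lyapunov_exp ::
  "('g, 'm) monoid_scheme \<Rightarrow> ('g \<Rightarrow> rp1 \<Rightarrow> rp1) \<Rightarrow> 'g set \<Rightarrow> rp1 \<Rightarrow> ereal" where
  "lyapunov_exp G \<phi> F x =
     limsup (\<lambda>n. ereal (Max ((\<lambda>g. (1 / real n) * ln (circle_deriv (\<phi> g) x)) `
                              {g \<in> carrier G. word_length G F g \<le> n})))"


section \<open>The modular group\<close>

definition SL2Z :: "(int^2^2) monoid" where
  "SL2Z = \<lparr>carrier = {A. det A = 1}, monoid.mult = (**), one = mat 1\<rparr>"

definition PSL2Z :: "(int^2^2) set monoid" where
  "PSL2Z = SL2Z Mod {mat 1, - mat 1}"

definition pm_mat :: "int \<Rightarrow> int \<Rightarrow> int \<Rightarrow> int \<Rightarrow> (int^2^2) set" where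
  "pm_mat a b c d =
     {vector [vector [a, b], vector [c, d]], - vector [vector [a, b], vector [c, d]]}"

text \<open>Both matrices \<open>A\<close> and \<open>- A\<close> of a class send a line to the same line, so the union below is
  the image of the line under either of them.\<close>

definition psl_act :: "(int^2^2) set \<Rightarrow> rp1 \<Rightarrow> rp1" where
  "psl_act C x = Abs_rp1 (\<Union>A\<in>C. (\<lambda>v. map_matrix real_of_int A *v v) ` Rep_rp1 x)"


section \<open>Basic facts\<close>

lemma line_through_eq_iff:
  assumes "v \<noteq> 0" "w \<noteq> 0"
  shows "line_through v = line_through w \<longleftrightarrow> v$1 * w$2 = v$2 * w$1"
proof -
  have "line_through v = line_through w \<longleftrightarrow> span {v} = span {w}"
    unfolding line_through_def using assms by (subst Abs_rp1_inject) auto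
  also have "\<dots> \<longleftrightarrow> v$1 * w$2 = v$2 * w$1"
  proof
    assume "span {v} = span {w}"
    then have "v \<in> span {w}"
      by (metis insertI1 span_base)
    then obtain k where "v = k *\<^sub>R w"
      by (auto simp: span_singleton)
    then show "v$1 * w$2 = v$2 * w$1" by simp
  next
    assume eq: "v$1 * w$2 = v$2 * w$1"
    have sub: "span {v} \<subseteq> span {w}"
      if "v \<noteq> 0" "w \<noteq> 0" "v$1 * w$2 = v$2 * w$1" for v w :: "real^2"
    proof -
      have "\<exists>k. v = k *\<^sub>R w"
      proof (cases "w$1 = 0")
        case True
        then have w2: "w$2 \<noteq> 0"
          using that(2) by (auto simp: vec_eq_iff forall_2)
        then have "v = (v$2 / w$2) *\<^sub>R w"
          using True that(3) by (auto simp: vec_eq_iff forall_2)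
        then show ?thesis by blast
      next
        case False
        then have "v = (v$1 / w$1) *\<^sub>R w"
          using that(3) by (auto simp: vec_eq_iff forall_2 field_simps)
        then show ?thesis by blast
      qed
      then have "v \<in> span {w}"
        by (auto simp: span_singleton)
      then show ?thesis
        by (simp add: span_minimal)
    qed
    show "span {v} = span {w}"
      using sub[OF assms eq] sub[OF assms(2,1)] eq by (simp add: mult.commute)
  qed
  finally show ?thesis .
qed

lemma unit_vec_nonzero: "(vector [cos t, sin t] :: real^2) \<noteq> 0"
  by (auto simp: vec_eq_iff forall_2 dest: sin_zero_abs_cos_one)

lemma circle_pt_eq_iff: "circle_pt s = circle_pt t \<longleftrightarrow> (\<exists>k::int. s - t = of_int k * pi)"
proof -
  have "circle_pt s = circle_pt t \<longleftrightarrow> sin (s - t) = 0"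
    unfolding circle_pt_def by (auto simp: line_through_eq_iff unit_vec_nonzero sin_diff algebra_simps)
  then show ?thesis
    by (simp add: sin_zero_iff_int2)
qed

lemma surj_circle_pt: "surj circle_pt"
proof -
  have "\<exists>t. x = circle_pt t" for x
  proof -
    obtain v where v: "v \<noteq> 0" "x = line_through v"
      using Rep_rp1[of x] Rep_rp1_inverse[of x] unfolding line_through_def by auto
    define r where "r = norm v"
    have r: "r > 0" "(v$1)\<^sup>2 + (v$2)\<^sup>2 = r\<^sup>2"
      using v(1) by (simp_all only: r_def power2_norm_eq_inner) (simp_all add: inner_vec_def sum_2 power2_eq_square)
    then have "(v$1 / r)\<^sup>2 + (v$2 / r)\<^sup>2 = 1"
      by (simp add: power_divide add_divide_distrib[symmetric])
    then obtain t where t: "v$1 / r = cos t" "v$2 / r = sin t"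
      using sincos_total_2pi by metis
    then have "v$1 = r * cos t" "v$2 = r * sin t"
      using r by (auto simp: field_simps)
    then show ?thesis
      using v unit_vec_nonzero[of t] unfolding circle_pt_def
      by (intro exI[of _ t]) (simp add: line_through_eq_iff)
  qed
  then show ?thesis by (auto simp: surj_def)
qed

lemma continuous_on_circle_pt: "continuous_on UNIV circle_pt"
  by (auto simp: continuous_on_open_vimage open_rp1_def)

lemma measurable_circle_pt: "circle_pt \<in> lebesgue_on {0..<pi} \<rightarrow>\<^sub>M borel"
  using borel_measurable_continuous_onI[OF continuous_on_circle_pt]
  by (simp add: measurable_completion measurable_restrict_space1)

lemma has_circle_deriv_unique:
  assumes "has_circle_deriv f D x" "has_circle_deriv f E x"
  shows "D = E"
proof -
  obtain \<theta> h where h: "x = circle_pt \<theta>" "\<forall>\<^sub>F t in nhds \<theta>. f (circle_pt t) = circle_pt (h t)"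
      "(h has_real_derivative D) (at \<theta>)"
    using assms(1) unfolding has_circle_deriv_def by blast
  obtain \<theta>' h' where h': "x = circle_pt \<theta>'" "\<forall>\<^sub>F t in nhds \<theta>'. f (circle_pt t) = circle_pt (h' t)"
      "(h' has_real_derivative E) (at \<theta>')"
    using assms(2) unfolding has_circle_deriv_def by blast
  obtain k :: int where k: "\<theta>' = \<theta> + of_int k * pi"
    using h(1) h'(1) circle_pt_eq_iff[of \<theta>' \<theta>] by (auto simp: algebra_simps)
  define q where "q = (\<lambda>t. h' (t + of_int k * pi))"
  have per: "circle_pt (t + of_int k * pi) = circle_pt t" for t
    by (auto simp: circle_pt_eq_iff)
  have qd: "(q has_real_derivative E) (at \<theta>)"
    unfolding q_def using h'(3) k DERIV_shift by metis
  have tend: "((\<lambda>t. t + of_int k * pi) \<longlongrightarrow> \<theta>') (nhds \<theta>)"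
    unfolding k by (intro tendsto_intros filterlim_ident)
  have qe: "\<forall>\<^sub>F t in nhds \<theta>. f (circle_pt t) = circle_pt (q t)"
    using eventually_compose_filterlim[OF h'(2) tend] by (simp add: per q_def)
  define d where "d = (\<lambda>t. (h t - q t) / pi)"
  have dd: "(d has_real_derivative (D - E) / pi) (at \<theta>)"
    unfolding d_def by (auto intro!: derivative_eq_intros h(3) qd)
  have "\<forall>\<^sub>F t in nhds \<theta>. circle_pt (h t) = circle_pt (q t)"
    using h(2) qe by eventually_elim simp
  then have dint: "\<forall>\<^sub>F t in nhds \<theta>. d t \<in> \<int>"
    by eventually_elim (auto simp: circle_pt_eq_iff d_def)
  have "isCont d \<theta>"
    using dd by (rule DERIV_isCont)
  then have "(d \<longlongrightarrow> d \<theta>) (nhds \<theta>)"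
    by (simp add: continuous_at tendsto_nhds_iff)
  then have "\<forall>\<^sub>F t in nhds \<theta>. dist (d t) (d \<theta>) < 1"
    by (rule tendstoD) simp
  then have const: "\<forall>\<^sub>F t in nhds \<theta>. d t = d \<theta>"
    using dint
  proof eventually_elim
    case (elim t)
    have "d \<theta> \<in> \<int>"
      using dint by (rule eventually_nhds_x_imp_x)
    then have "d t - d \<theta> \<in> \<int>" "\<bar>d t - d \<theta>\<bar> < 1"
      using elim by (auto simp: dist_real_def)
    then show ?case
      using Ints_nonzero_abs_less1 by force
  qed
  have "((\<lambda>_. d \<theta>) has_real_derivative (D - E) / pi) (at \<theta>)"
    using dd const DERIV_cong_ev[OF refl const refl] by simp
  then have "(D - E) / pi = 0"
    using DERIV_unique DERIV_const by blast
  then show ?thesis by simp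
qed

lemma circle_deriv_eq: "has_circle_deriv f D x \<Longrightarrow> circle_deriv f x = D"
  unfolding circle_deriv_def using has_circle_deriv_unique by blast

lemma carrier_PSL2Z: "carrier PSL2Z = {pm_mat a b c d | a b c d. a * d - b * c = 1}"
proof -
  have neg: "(- mat 1 :: int^2^2) ** A = - A" for A
    by (simp add: vec_eq_iff forall_2 matrix_matrix_mult_def mat_def sum_2)
  have "carrier PSL2Z = (\<lambda>A. {A, - A}) ` {A. det A = 1}"
    unfolding PSL2Z_def carrier_FactGroup SL2Z_def r_coset_def by (simp add: neg insert_commute)
  also have "\<dots> = {pm_mat a b c d | a b c d. a * d - b * c = 1}"
  proof (intro equalityI subsetI)
    fix C assume "C \<in> (\<lambda>A. {A, - A}) ` {A :: int^2^2. det A = 1}"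
    then obtain A :: "int^2^2" where A: "det A = 1" "C = {A, - A}" by blast
    have "A = vector [vector [A$1$1, A$1$2], vector [A$2$1, A$2$2]]"
      by (simp add: vec_eq_iff forall_2)
    then have "C = pm_mat (A$1$1) (A$1$2) (A$2$1) (A$2$2)"
      using A(2) unfolding pm_mat_def by metis
    then show "C \<in> {pm_mat a b c d | a b c d. a * d - b * c = 1}"
      using A(1) by (auto simp: det_2)
  next
    fix C assume "C \<in> {pm_mat a b c d | a b c d. a * d - b * c = 1}"
    then show "C \<in> (\<lambda>A. {A, - A}) ` {A :: int^2^2. det A = 1}"
      by (auto simp: pm_mat_def det_2)
  qed
  finally show ?thesis .
qed

lemma psl_act_line_through:
  assumes "a * d - b * c = 1" "v \<noteq> 0"
  shows "psl_act (pm_mat a b c d) (line_through v) =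
           line_through (vector [of_int a * v$1 + of_int b * v$2, of_int c * v$1 + of_int d * v$2])"
proof -
  have rep: "Rep_rp1 (line_through v) = span {v}"
    unfolding line_through_def by (rule Abs_rp1_inverse) (use assms(2) in auto)
  define w :: "real^2" where
    "w = vector [of_int a * v$1 + of_int b * v$2, of_int c * v$1 + of_int d * v$2]"
  let ?A = "vector [vector [a, b], vector [c, d]] :: int^2^2"
  have p: "map_matrix real_of_int ?A *v (k *\<^sub>R v) = k *\<^sub>R w" for k
    by (simp add: w_def vec_eq_iff forall_2 matrix_vector_mult_def sum_2 algebra_simps)
  have m: "map_matrix real_of_int (- ?A) *v (k *\<^sub>R v) = (- k) *\<^sub>R w" for k
    by (simp add: w_def vec_eq_iff forall_2 matrix_vector_mult_def sum_2 algebra_simps)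
  have "(\<Union>A\<in>pm_mat a b c d. (\<lambda>v. map_matrix real_of_int A *v v) ` span {v}) = span {w}"
    unfolding pm_mat_def span_singleton by (auto simp: p m image_image simp del: scaleR_minus_left)
  then show ?thesis
    unfolding psl_act_def rep by (simp add: line_through_def w_def)
qed

lemma psl_act_affine_pt:
  assumes "a * d - b * c = 1"
  shows "psl_act (pm_mat a b c d) (affine_pt x) =
           (if of_int c * x + of_int d = 0 then infinity_pt
            else affine_pt ((of_int a * x + of_int b) / (of_int c * x + of_int d)))"
proof -
  have *: "(of_int a * x + of_int b \<noteq> 0) \<or> (of_int c * x + of_int d \<noteq> 0)"
  proof (rule ccontr)
    assume "\<not> ?thesis"
    then have e: "of_int a * x + of_int b = 0" "of_int c * x + of_int d = 0" by auto
    have "real_of_int (a * d - b * c) = 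
        of_int a * (of_int c * x + of_int d) - of_int c * (of_int a * x + of_int b)"
      by (simp add: algebra_simps)
    then show False using e assms by simp
  qed
  have "(vector [x, 1] :: real^2) \<noteq> 0"
    by (simp add: vec_eq_iff forall_2)
  from psl_act_line_through[OF assms this] show ?thesis
    unfolding affine_pt_def infinity_pt_def using *
    by (auto simp: line_through_eq_iff vec_eq_iff forall_2)
qed

lemma psl_act_infinity_pt:
  assumes "a * d - b * c = 1"
  shows "psl_act (pm_mat a b c d) infinity_pt =
           (if c = 0 then infinity_pt else affine_pt (of_int a / of_int c))"
proof -
  have *: "a \<noteq> 0 \<or> c \<noteq> 0"
    using assms by auto
  have "(vector [1, 0] :: real^2) \<noteq> 0"
    by (simp add: vec_eq_iff forall_2)
  from psl_act_line_through[OF assms this] show ?thesis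
    unfolding affine_pt_def infinity_pt_def using *
    by (auto simp: line_through_eq_iff vec_eq_iff forall_2)
qed

lemma has_circle_deriv_psl_act:
  assumes "a * d - b * c = 1"
  shows "has_circle_deriv (psl_act (pm_mat a b c d))
           (1 / ((of_int a * cos \<theta> + of_int b * sin \<theta>)\<^sup>2 + (of_int c * cos \<theta> + of_int d * sin \<theta>)\<^sup>2))
           (circle_pt \<theta>)"
proof -
  define p where "p = (\<lambda>t. real_of_int a * cos t + of_int b * sin t)"
  define q where "q = (\<lambda>t. real_of_int c * cos t + of_int d * sin t)"
  define P where "P = p \<theta>"
  define Q where "Q = q \<theta>"
  define N where "N = P\<^sup>2 + Q\<^sup>2"
  have ad: "real_of_int a * of_int d - of_int b * of_int c = 1"
    using assms by (metis of_int_1 of_int_diff of_int_mult)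
  have pq: "of_int d * p t - of_int b * q t = cos t" "of_int a * q t - of_int c * p t = sin t" for t
  proof -
    have "of_int d * p t - of_int b * q t = (of_int a * of_int d - of_int b * of_int c) * cos t"
      by (simp add: p_def q_def algebra_simps)
    then show "of_int d * p t - of_int b * q t = cos t" using ad by simp
    have "of_int a * q t - of_int c * p t = (of_int a * of_int d - of_int b * of_int c) * sin t"
      by (simp add: p_def q_def algebra_simps)
    then show "of_int a * q t - of_int c * p t = sin t" using ad by simp
  qed
  have nz: "p t \<noteq> 0 \<or> q t \<noteq> 0" for t
    using pq[of t] sin_zero_abs_cos_one[of t] by auto
  have N: "N > 0"
    using nz[of \<theta>] by (auto simp: N_def P_def Q_def sum_power2_gt_zero_iff)
  have "(P / sqrt N)\<^sup>2 + (Q / sqrt N)\<^sup>2 = 1"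
    using N by (simp add: power_divide add_divide_distrib[symmetric] N_def[symmetric])
  then obtain \<alpha> where \<alpha>: "P / sqrt N = cos \<alpha>" "Q / sqrt N = sin \<alpha>"
    using sincos_total_2pi by metis
  have \<alpha>': "P = sqrt N * cos \<alpha>" "Q = sqrt N * sin \<alpha>"
    using \<alpha> N by (auto simp: field_simps)
  define dot where "dot = (\<lambda>t. P * p t + Q * q t)"
  define crs where "crs = (\<lambda>t. P * q t - Q * p t)"
  define h where "h = (\<lambda>t. \<alpha> + arctan (crs t / dot t))"
  have dot0: "dot \<theta> = N" and crs0: "crs \<theta> = 0"
    by (auto simp: dot_def crs_def P_def Q_def N_def power2_eq_square)
  define p' where "p' = - real_of_int a * sin \<theta> + of_int b * cos \<theta>"
  define q' where "q' = - real_of_int c * sin \<theta> + of_int d * cos \<theta>"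
  have dp: "(p has_real_derivative p') (at \<theta>)" and dq: "(q has_real_derivative q') (at \<theta>)"
    unfolding p_def q_def p'_def q'_def by (auto intro!: derivative_eq_intros)
  have ddot: "(dot has_real_derivative P * p' + Q * q') (at \<theta>)"
    unfolding dot_def by (auto intro!: derivative_eq_intros dp dq)
  have dcrs: "(crs has_real_derivative P * q' - Q * p') (at \<theta>)"
    unfolding crs_def by (auto intro!: derivative_eq_intros dp dq)
  have "P * q' - Q * p' =
      (of_int a * of_int d - of_int b * of_int c) * ((cos \<theta>)\<^sup>2 + (sin \<theta>)\<^sup>2)"
    by (simp only: P_def Q_def p_def q_def p'_def q'_def) algebra
  then have det: "P * q' - Q * p' = 1"
    using ad by simp
  have dh: "(h has_real_derivative 1 / N) (at \<theta>)"
    unfolding h_def using N det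
    by (auto intro!: derivative_eq_intros ddot dcrs simp: dot0 crs0 power2_eq_square divide_simps)
  have "isCont dot \<theta>"
    using ddot by (rule DERIV_isCont)
  then have "(dot \<longlongrightarrow> N) (nhds \<theta>)"
    using dot0 by (simp add: continuous_at tendsto_nhds_iff)
  then have "\<forall>\<^sub>F t in nhds \<theta>. dot t > 0"
    using N by (rule order_tendstoD)
  then have "\<forall>\<^sub>F t in nhds \<theta>. psl_act (pm_mat a b c d) (circle_pt t) = circle_pt (h t)"
  proof eventually_elim
    case (elim t)
    define \<beta> where "\<beta> = arctan (crs t / dot t)"
    have "cos \<beta> > 0" "tan \<beta> = crs t / dot t"
      using arctan[of "crs t / dot t"] cos_gt_zero_pi by (auto simp: \<beta>_def)
    then have sb: "sin \<beta> * dot t = cos \<beta> * crs t"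
      using elim by (auto simp: tan_def field_simps)
    have nn: "P * dot t - Q * crs t = N * p t" "Q * dot t + P * crs t = N * q t"
      by (simp_all add: dot_def crs_def N_def power2_eq_square algebra_simps)
    have "(sqrt N * dot t) * cos (h t) = dot t * (P * cos \<beta>) - Q * (sin \<beta> * dot t)"
      by (simp add: h_def \<beta>_def[symmetric] cos_add \<alpha>' algebra_simps)
    also have "\<dots> = cos \<beta> * (P * dot t - Q * crs t)"
      by (simp add: sb algebra_simps)
    finally have c: "(sqrt N * dot t) * cos (h t) = cos \<beta> * N * p t"
      using nn by simp
    have "(sqrt N * dot t) * sin (h t) = dot t * (Q * cos \<beta>) + P * (sin \<beta> * dot t)"
      by (simp add: h_def \<beta>_def[symmetric] sin_add \<alpha>' algebra_simps)
    also have "\<dots> = cos \<beta> * (Q * dot t + P * crs t)"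
      by (simp add: sb algebra_simps)
    finally have s: "(sqrt N * dot t) * sin (h t) = cos \<beta> * N * q t"
      using nn by simp
    have "(sqrt N * dot t) * (p t * sin (h t)) = p t * ((sqrt N * dot t) * sin (h t))"
      by (simp add: mult_ac)
    also have "\<dots> = q t * ((sqrt N * dot t) * cos (h t))"
      unfolding s c by (simp add: mult_ac)
    also have "\<dots> = (sqrt N * dot t) * (q t * cos (h t))"
      by (simp add: mult_ac)
    finally have e: "p t * sin (h t) = q t * cos (h t)"
      using N elim by simp
    have "psl_act (pm_mat a b c d) (circle_pt t) = line_through (vector [p t, q t])"
      unfolding circle_pt_def psl_act_line_through[OF assms unit_vec_nonzero] by (simp add: p_def q_def)
    also have "\<dots> = circle_pt (h t)"
      unfolding circle_pt_def using nz[of t] e sin_zero_abs_cos_one[of "h t"]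
      by (subst line_through_eq_iff) (auto simp: unit_vec_nonzero vec_eq_iff forall_2)
    finally show ?case .
  qed
  then show ?thesis
    using dh unfolding has_circle_deriv_def N_def P_def Q_def p_def q_def by blast
qed

end

theory Submission
  imports Defs "HOL-Real_Asymp.Real_Asymp"
begin

text \<open>At the direction \<open>w\<close> the derivative of the class of a matrix \<open>A\<close> is \<open>1 / \<bar>A w\<bar>\<^sup>2\<close> for a unit vector
  \<open>w = (u, v)\<close>. If \<open>u\<close> and \<open>v\<close> are both nonzero, one of \<open>(u \<plusminus> v, v)\<close> and \<open>(u, v \<plusminus> u)\<close> is
  shorter than \<open>w\<close>, while integer vectors have length at least 1; this determines the
  non-expandable points.

  For the Lyapunov exponent, no word of length \<open>n\<close> contracts \<open>w\<close> more than \<open>K n\<close> steps of the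
  subtractive Euclidean algorithm do. The directions which \<open>n\<close> steps of the algorithm contract by more
  than \<open>exp (- \<epsilon> n)\<close> lie in Farey intervals of level \<open>n\<close> with large denominators. Their total length
  decays exponentially by a supersolution argument on the Farey tree, so the Borel-Cantelli lemma
  shows that almost every direction is contracted subexponentially.\<close>

section \<open>The subtractive Euclidean algorithm\<close>

text \<open>Absolute values are taken at each step, so signs never matter; the pair reached is
  measured in the maximum norm.\<close>

fun euclid :: "nat \<Rightarrow> real \<Rightarrow> real \<Rightarrow> real" where
  "euclid 0 p q = max \<bar>p\<bar> \<bar>q\<bar>"
| "euclid (Suc n) p q = euclid n \<bar>\<bar>p\<bar> - \<bar>q\<bar>\<bar> (min \<bar>p\<bar> \<bar>q\<bar>)"

declare euclid.simps(2) [simp del]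

lemmas euclid_Suc = euclid.simps(2)

lemma euclid_swap: "euclid n q p = euclid n p q"
  by (cases n) (auto simp: euclid_Suc max.commute min.commute abs_minus_commute)

lemma euclid_cong_abs:
  assumes "\<bar>p\<bar> = \<bar>p'\<bar>" "\<bar>q\<bar> = \<bar>q'\<bar>"
  shows "euclid n p q = euclid n p' q'"
  using assms by (cases n) (auto simp: euclid_Suc)

lemma euclid_Suc_le: "euclid (Suc n) p q \<le> euclid n p q"
proof (induction n arbitrary: p q)
  case 0
  show ?case by (auto simp: euclid_Suc)
next
  case (Suc n)
  show ?case
    using Suc.IH by (simp only: euclid_Suc[of "Suc n" p q] euclid_Suc[of n p q])
qed

lemma euclid_antimono: "m \<le> n \<Longrightarrow> euclid n p q \<le> euclid m p q"
  by (rule lift_Suc_antimono_le[of "\<lambda>n. euclid n p q"]) (rule euclid_Suc_le)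

text \<open>A shear costs at most one step. For equal signs the next step undoes it; for opposite
  signs with \<open>|q| \<le> |p|\<close> it is itself the step; otherwise one step from
  \<open>(p + q, q)\<close> and one from \<open>(p, q)\<close> lead to the same pair up to
  order.\<close>

lemma euclid_add_le: "euclid (Suc n) p q \<le> euclid n (p + q) q"
proof (cases n)
  case 0
  show ?thesis unfolding 0 euclid_Suc by auto
next
  case (Suc m)
  consider "p * q \<ge> 0" | "p * q < 0" "\<bar>q\<bar> \<le> \<bar>p\<bar>" | "p * q < 0" "\<bar>p\<bar> < \<bar>q\<bar>"
    by linarith
  then show ?thesis
  proof cases
    case 1
    then have "\<bar>p + q\<bar> = \<bar>p\<bar> + \<bar>q\<bar>"
      by (auto simp: zero_le_mult_iff)
    then have "euclid n (p + q) q = euclid m \<bar>p\<bar> \<bar>q\<bar>"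
      by (simp add: Suc euclid_Suc)
    also have "\<dots> = euclid m p q"
      by (rule euclid_cong_abs) auto
    finally show ?thesis
      unfolding Suc using euclid_antimono[of m "Suc (Suc m)" p q] by simp
  next
    case 2
    then have "\<bar>p + q\<bar> = \<bar>p\<bar> - \<bar>q\<bar>"
      by (auto simp: mult_less_0_iff)
    then have "euclid n (p + q) q = euclid n \<bar>\<bar>p\<bar> - \<bar>q\<bar>\<bar> (min \<bar>p\<bar> \<bar>q\<bar>)"
      using 2 by (intro euclid_cong_abs) auto
    then show ?thesis by (simp add: euclid_Suc)
  next
    case 3
    then have "\<bar>p + q\<bar> = \<bar>q\<bar> - \<bar>p\<bar>"
      by (auto simp: mult_less_0_iff)
    then have "euclid n (p + q) q = euclid m \<bar>p\<bar> (\<bar>q\<bar> - \<bar>p\<bar>)"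
      using 3 by (simp add: Suc euclid_Suc)
    also have "\<dots> = euclid (Suc m) p q"
      using 3 by (subst euclid_swap) (simp add: euclid_Suc)
    finally show ?thesis
      unfolding Suc using euclid_Suc_le[of "Suc m" p q] by simp
  qed
qed

lemma euclid_diff_le: "euclid (Suc n) p q \<le> euclid n (p - q) q"
proof -
  have "euclid (Suc n) p q = euclid (Suc n) p (- q)"
    by (rule euclid_cong_abs) auto
  also have "\<dots> \<le> euclid n (p + - q) (- q)"
    by (rule euclid_add_le)
  also have "\<dots> = euclid n (p - q) q"
    by (rule euclid_cong_abs) auto
  finally show ?thesis .
qed

lemma euclid_mult: "euclid n (c * p) (c * q) = \<bar>c\<bar> * euclid n p q"
proof (induction n arbitrary: c p q)
  case 0
  show ?case by (simp add: abs_mult max_mult_distrib_left)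
next
  case (Suc n)
  have "euclid (Suc n) (c * p) (c * q) = euclid n (\<bar>c\<bar> * \<bar>\<bar>p\<bar> - \<bar>q\<bar>\<bar>) (\<bar>c\<bar> * min \<bar>p\<bar> \<bar>q\<bar>)"
    by (simp add: euclid_Suc abs_mult min_mult_distrib_left right_diff_distrib[symmetric])
  then show ?case
    using Suc.IH[of "\<bar>c\<bar>"] by (simp add: euclid_Suc)
qed

lemma euclid_pos: "p \<noteq> 0 \<or> q \<noteq> 0 \<Longrightarrow> euclid n p q > 0"
proof (induction n arbitrary: p q)
  case 0
  then show ?case by auto
next
  case (Suc n)
  then have "\<bar>\<bar>p\<bar> - \<bar>q\<bar>\<bar> \<noteq> 0 \<or> min \<bar>p\<bar> \<bar>q\<bar> \<noteq> 0" by auto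
  then show ?case using Suc.IH by (simp add: euclid_Suc)
qed

lemma continuous_on_euclid [continuous_intros]:
  "continuous_on A f \<Longrightarrow> continuous_on A g \<Longrightarrow> continuous_on A (\<lambda>x. euclid n (f x) (g x))"
proof (induction n arbitrary: f g)
  case 0
  then show ?case by (auto intro!: continuous_intros)
next
  case (Suc n)
  show ?case
    unfolding euclid_Suc by (intro Suc.IH continuous_intros Suc.prems)
qed

section \<open>Delays of integer matrices\<close>

text \<open>Delays add up under products, so a word of length \<open>n\<close> contracts a vector at most as much as
  a number of steps of the algorithm linear in \<open>n\<close>.\<close>

definition delay :: "nat \<Rightarrow> int \<Rightarrow> int \<Rightarrow> int \<Rightarrow> int \<Rightarrow> bool" where
  "delay K a b c d \<longleftrightarrow>
     (\<forall>m p q. euclid (m + K) p q \<le> euclid m (of_int a * p + of_int b * q) (of_int c * p + of_int d * q))"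

lemma delay_mono: "delay K a b c d \<Longrightarrow> K \<le> L \<Longrightarrow> delay L a b c d"
  unfolding delay_def using euclid_antimono[of "_ + K" "_ + L"] by (meson add_left_mono order_trans)

lemma delay_mult:
  assumes "delay K a b c d" "delay L a' b' c' d'"
  shows "delay (K + L) (a * a' + b * c') (a * b' + b * d') (c * a' + d * c') (c * b' + d * d')"
  unfolding delay_def
proof (intro allI)
  fix m and p q :: real
  let ?p = "of_int a' * p + of_int b' * q" and ?q = "of_int c' * p + of_int d' * q"
  have "euclid (m + (K + L)) p q \<le> euclid (m + K) ?p ?q"
    using assms(2) unfolding delay_def by (metis add.assoc)
  also have "\<dots> \<le> euclid m (of_int a * ?p + of_int b * ?q) (of_int c * ?p + of_int d * ?q)"
    using assms(1) unfolding delay_def by blast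
  finally show "euclid (m + (K + L)) p q \<le>
      euclid m (of_int (a * a' + b * c') * p + of_int (a * b' + b * d') * q)
               (of_int (c * a' + d * c') * p + of_int (c * b' + d * d') * q)"
    by (simp add: algebra_simps)
qed

lemma delay_sign: "\<bar>e\<bar> = 1 \<Longrightarrow> \<bar>f\<bar> = 1 \<Longrightarrow> delay 0 e 0 0 f"
  unfolding delay_def by (auto intro!: eq_refl euclid_cong_abs simp: abs_mult simp flip: of_int_abs)

lemma delay_swap: "delay 0 0 1 1 0"
  by (simp add: delay_def euclid_swap)

lemma delay_shear: "\<bar>e\<bar> = 1 \<Longrightarrow> delay 1 1 e 0 1"
  using euclid_add_le euclid_diff_le by (cases "e = 1") (auto simp: delay_def abs_if split: if_splits)

lemma delay_shear': "\<bar>e\<bar> = 1 \<Longrightarrow> delay 1 1 0 e 1"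
  using delay_mult[OF delay_mult[OF delay_swap delay_shear] delay_swap, of e] by simp

lemma ex_delay_upper: "\<exists>K. delay K 1 b 0 1"
proof (induction "nat \<bar>b\<bar>" arbitrary: b)
  case 0
  then show ?case using delay_sign[of 1 1] by auto
next
  case (Suc n)
  then have "n = nat \<bar>b - sgn b\<bar>" "\<bar>sgn b\<bar> = 1" by (auto simp: sgn_if)
  then obtain K where "delay K 1 (b - sgn b) 0 1" using Suc(1) by blast
  from delay_mult[OF this delay_shear[of "sgn b"]] \<open>\<bar>sgn b\<bar> = 1\<close> show ?case by auto
qed

text \<open>Euclid's algorithm on the first column: shears of delay 1 reduce
  \<open>|a| + |c|\<close> until an entry vanishes, and what remains is triangular up to a
  swap.\<close>

lemma ex_delay_det: "\<bar>a * d - b * c\<bar> = 1 \<Longrightarrow> \<exists>K. delay K a b c d"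
proof (induction "nat (\<bar>a\<bar> + \<bar>c\<bar>)" arbitrary: a b c d rule: less_induct)
  case less
  have zero: "\<exists>K. delay K a b 0 d" if "\<bar>a * d\<bar> = 1" for a b d :: int
  proof -
    have "\<bar>a\<bar> = 1" "\<bar>d\<bar> = 1"
      using that by (auto simp: abs_mult zmult_eq_1_iff)
    then have "a * a = 1" by (auto simp: abs_if split: if_splits)
    \<comment> \<open>The sign matrix with diagonal \<open>a\<close>, \<open>1\<close> multiplies
      this entry by \<open>a\<close> again, and \<open>a * a = 1\<close>.\<close>
    obtain K where "delay K 1 (a * b) 0 1"
      using ex_delay_upper by blast
    from delay_mult[OF delay_sign[OF \<open>\<bar>a\<bar> = 1\<close> abs_one] this]
    have "delay K a b 0 1"
      using \<open>a * a = 1\<close> by (simp add: mult.assoc[symmetric])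
    from delay_mult[OF delay_sign[OF abs_one \<open>\<bar>d\<bar> = 1\<close>] this] show ?thesis
      by auto
  qed
  consider "c = 0" | "a = 0" | "a \<noteq> 0" "c \<noteq> 0" "\<bar>c\<bar> \<le> \<bar>a\<bar>" | "a \<noteq> 0" "c \<noteq> 0" "\<bar>a\<bar> \<le> \<bar>c\<bar>"
    by linarith
  then show ?case
  proof cases
    case 1
    then show ?thesis using zero less.prems by simp
  next
    case 2
    then obtain K where "delay K c d 0 b"
      using zero[of c b d] less.prems by (auto simp: mult.commute)
    from delay_mult[OF delay_swap this] 2 show ?thesis by auto
  next
    case 3
    \<comment> \<open>With this choice \<open>e * c\<close> has the sign of \<open>a\<close>, so
      subtracting it shortens \<open>a\<close>.\<close>
    define e where "e = sgn a * sgn c"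
    have e: "\<bar>e\<bar> = 1" "\<bar>a - e * c\<bar> < \<bar>a\<bar>"
      using 3 by (auto simp: e_def sgn_if)
    then have "nat (\<bar>a - e * c\<bar> + \<bar>c\<bar>) < nat (\<bar>a\<bar> + \<bar>c\<bar>)" by auto
    moreover have "(a - e * c) * d - (b - e * d) * c = a * d - b * c"
      by (simp add: algebra_simps)
    ultimately obtain K where "delay K (a - e * c) (b - e * d) c d"
      using less by metis
    from delay_mult[OF delay_shear[OF e(1)] this] show ?thesis by auto
  next
    case 4
    define e where "e = sgn a * sgn c"
    have e: "\<bar>e\<bar> = 1" "\<bar>c - e * a\<bar> < \<bar>c\<bar>"
      using 4 by (auto simp: e_def sgn_if)
    then have "nat (\<bar>a\<bar> + \<bar>c - e * a\<bar>) < nat (\<bar>a\<bar> + \<bar>c\<bar>)" by auto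
    moreover have "a * (d - e * b) - b * (c - e * a) = a * d - b * c"
      by (simp add: algebra_simps)
    ultimately obtain K where "delay K a b (c - e * a) (d - e * b)"
      using less by metis
    from delay_mult[OF delay_shear'[OF e(1)] this] show ?thesis by auto
  qed
qed

section \<open>A supersolution for the Farey tree\<close>

text \<open>The pairs \<open>(X, Y)\<close> of the tree rooted at \<open>(1, 1)\<close> with children \<open>(X, X + Y)\<close> and
  \<open>(X + Y, Y)\<close> index Farey intervals of length \<open>1 / (X * Y)\<close>, and these lengths satisfy
  \<open>1 / (X * (X + Y)) + 1 / ((X + Y) * Y) = 1 / (X * Y)\<close>. The factor \<open>max X Y powr (2 * s)\<close> detects
  intervals on which the algorithm has contracted; at one step it costs a factor \<open>1 + 2 * s / r\<close> to
  first order in \<open>s\<close>, where \<open>r\<close> is the ratio of the larger entry to the smaller one. On ratios the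
  splitting is a null recurrent Markov chain, jumping from \<open>r\<close> to \<open>r + 1\<close> with probability
  \<open>r / (r + 1)\<close> and to \<open>(r + 1) / r\<close> otherwise, so the average of \<open>2 / r\<close> vanishes; the
  corrector is a bounded function whose drift absorbs \<open>2 / r\<close> up to \<open>\<eta>\<close>.\<close>

definition corrector :: "real \<Rightarrow> real \<Rightarrow> real" where
  "corrector \<eta> r = r * min 0 (\<eta> * ln r - 3)"

lemma corrector_nonpos: "0 < r \<Longrightarrow> corrector \<eta> r \<le> 0"
  unfolding corrector_def by (simp add: mult_nonneg_nonpos)

text \<open>The minimum cuts the corrector off where \<open>ln r\<close> reaches
  \<open>3 / \<eta>\<close>; below that, \<open>r \<le> exp (3 / \<eta>)\<close> and the other
  factor is at least \<open>- 3\<close>.\<close>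

lemma corrector_ge:
  assumes "\<eta> > 0" "r \<ge> 1"
  shows "- 3 * exp (3 / \<eta>) \<le> corrector \<eta> r"
proof (cases "\<eta> * ln r \<ge> 3")
  case True
  then show ?thesis by (simp add: corrector_def)
next
  case False
  then have "ln r \<le> 3 / \<eta>"
    using assms by (simp add: field_simps)
  then have r: "r \<le> exp (3 / \<eta>)"
    using assms by (metis exp_le_cancel_iff exp_ln less_le_trans zero_less_one)
  have "r * 3 \<le> exp (3 / \<eta>) * 3"
    using r by simp
  moreover have "r * (- 3) \<le> r * (\<eta> * ln r - 3)"
    using assms by (intro mult_left_mono) auto
  ultimately show ?thesis
    using False by (simp add: corrector_def)
qed

text \<open>Write the corrector as \<open>r * y r\<close>. The jump to \<open>(r + 1) / r\<close>
  contributes \<open>y ((r + 1) / r) / r\<close>, which pays for \<open>2 / r\<close>; the jump to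
  \<open>r + 1\<close> contributes \<open>r * y (r + 1)\<close>, and \<open>y\<close> grows by at
  most \<open>\<eta> / r\<close> there.\<close>

lemma corrector_drift:
  assumes "0 < \<eta>" "\<eta> \<le> 1" "r \<ge> 1"
  shows "corrector \<eta> ((r + 1) / r) / (r + 1) + r * corrector \<eta> (r + 1) / (r + 1) + 2 / r
           \<le> corrector \<eta> r + \<eta>"
proof -
  define y where "y = (\<lambda>r. min 0 (\<eta> * ln r - 3))"
  have "ln ((r + 1) / r) \<le> (r + 1) / r - 1"
    using assms by (intro ln_le_minus_one) auto
  then have l: "ln ((r + 1) / r) \<le> 1 / r"
    using assms by (simp add: field_simps)
  also have "1 / r \<le> 1"
    using assms by simp
  finally have l1: "ln ((r + 1) / r) \<le> 1" .
  \<comment> \<open>The constant 3 in \<open>corrector\<close> leaves \<open>- 2\<close> once the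
    logarithmic term has used up at most 1.\<close>
  have "\<eta> * ln ((r + 1) / r) \<le> 1 * 1"
    using assms l1 by (intro mult_mono) auto
  then have y1: "y ((r + 1) / r) \<le> - 2"
    by (simp add: y_def)
  have "\<eta> * ln (r + 1) - \<eta> * ln r = \<eta> * ln ((r + 1) / r)"
    using assms by (simp add: ln_div algebra_simps)
  also have "\<dots> \<le> \<eta> / r"
    using mult_left_mono[OF l, of \<eta>] assms by simp
  finally have "\<eta> * ln (r + 1) \<le> \<eta> * ln r + \<eta> / r"
    by simp
  moreover have "0 \<le> \<eta> / r"
    using assms by simp
  ultimately have y2: "y (r + 1) \<le> y r + \<eta> / r"
    unfolding y_def by linarith
  have "corrector \<eta> ((r + 1) / r) / (r + 1) = y ((r + 1) / r) / r"
    using assms by (simp add: corrector_def y_def)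
  also have "\<dots> \<le> (- 2) / r"
    using y1 assms by (intro divide_right_mono) auto
  finally have 1: "corrector \<eta> ((r + 1) / r) / (r + 1) \<le> (- 2) / r" .
  have "r * corrector \<eta> (r + 1) / (r + 1) = r * y (r + 1)"
    using assms by (simp add: corrector_def y_def)
  also have "\<dots> \<le> r * (y r + \<eta> / r)"
    using y2 assms by (intro mult_left_mono) auto
  also have "\<dots> = corrector \<eta> r + \<eta>"
    using assms by (simp add: corrector_def y_def algebra_simps)
  finally show ?thesis
    using 1 by simp
qed

text \<open>The length \<open>1 / (X * Y)\<close> of the Farey interval times the detecting factor;
  the factor with the corrector is the first-order term in \<open>s\<close> that makes the product a
  supersolution with growth \<open>1 + 4 * s * \<eta>\<close>.\<close>

definition farey_weight :: "real \<Rightarrow> real \<Rightarrow> real \<Rightarrow> real \<Rightarrow> real" where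
  "farey_weight \<eta> s X Y =
     max X Y powr (2 * s) * (1 + s * corrector \<eta> (max X Y / min X Y)) / (X * Y)"

lemma farey_weight_swap: "farey_weight \<eta> s Y X = farey_weight \<eta> s X Y"
  by (simp add: farey_weight_def max.commute min.commute mult.commute)

text \<open>The bound on \<open>s\<close> is half the reciprocal of the bound
  \<open>3 * exp (3 / \<eta>)\<close> on the size of the corrector.\<close>

lemma corrector_small:
  assumes "0 < \<eta>" "0 < s" "s \<le> exp (- 3 / \<eta>) / 6" "r \<ge> 1"
  shows "1 / 2 \<le> 1 + s * corrector \<eta> r" "1 + s * corrector \<eta> r \<le> 1"
proof -
  have "s * (3 * exp (3 / \<eta>)) \<le> exp (- 3 / \<eta>) / 6 * (3 * exp (3 / \<eta>))"
    using assms by (intro mult_right_mono) auto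
  also have "\<dots> = 1 / 2"
    by (simp add: exp_minus)
  finally have "s * (- 3 * exp (3 / \<eta>)) \<ge> - 1 / 2"
    by simp
  moreover have "s * corrector \<eta> r \<ge> s * (- 3 * exp (3 / \<eta>))"
    using assms by (intro mult_left_mono corrector_ge) auto
  ultimately show "1 / 2 \<le> 1 + s * corrector \<eta> r" by linarith
  show "1 + s * corrector \<eta> r \<le> 1"
    using assms corrector_nonpos[of r \<eta>] by (simp add: mult_nonneg_nonpos)
qed

text \<open>With \<open>r\<close> the ratio of the entries, the sum is the parent's weight with
  \<open>h r\<close> replaced by \<open>g * A\<close>. Here \<open>g\<close> is at most
  \<open>1 + 2 * s / r + 4 * s\<^sup>2\<close>, and the drift bound gives
  \<open>A \<le> h r + s * \<eta> - 2 * s / r\<close>, so the terms \<open>2 * s / r\<close>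
  cancel.\<close>

lemma farey_weight_step:
  assumes \<eta>: "0 < \<eta>" "\<eta> \<le> 1" and s: "0 < s" "s \<le> exp (- 3 / \<eta>) / 6" "4 * s \<le> \<eta>"
    and XY: "0 < X" "0 < Y"
  shows "farey_weight \<eta> s X (X + Y) + farey_weight \<eta> s (X + Y) Y
           \<le> (1 + 4 * s * \<eta>) * farey_weight \<eta> s X Y"
  using XY
proof (induction X Y rule: linorder_wlog)
  case (sym X Y)
  then show ?case
    using farey_weight_swap[of \<eta> s "X + Y"] farey_weight_swap[of \<eta> s X Y]
    by (simp add: add.commute)
next
  \<comment> \<open>The names are exchanged so that \<open>X\<close> is the larger entry; the claim
    is about \<open>Y\<close> and \<open>X\<close>, hence the swaps at the end.\<close>
  case (le Y X)
  define r where "r = X / Y"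
  have r: "r \<ge> 1" and X: "X = r * Y"
    using le by (auto simp: r_def)
  define h where "h = (\<lambda>r. 1 + s * corrector \<eta> r)"
  have h: "1 / 2 \<le> h t" "h t \<le> 1" if "t \<ge> 1" for t
    unfolding h_def using corrector_small[OF \<eta>(1) s(1,2) that] by auto
  define g where "g = ((r + 1) / r) powr (2 * s)"
  define A where "A = h ((r + 1) / r) / (r + 1) + r * h (r + 1) / (r + 1)"
  have rr: "(r + 1) / r \<ge> 1" "r + 1 \<ge> 1"
    using r by auto
  have A_eq: "A = 1 + s * (corrector \<eta> ((r + 1) / r) / (r + 1) + r * corrector \<eta> (r + 1) / (r + 1))"
  proof -
    have "(1 + s * u) / t + r * (1 + s * v) / t = (r + 1) / t + s * (u / t + r * v / t)" for t u v
      by (cases "t = 0") (simp_all add: field_simps)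
    from this[where t = "r + 1"] show ?thesis
      using r by (simp add: A_def h_def)
  qed
  have "A + s * (2 / r) \<le> h r + s * \<eta>"
  proof -
    have "s * (corrector \<eta> ((r + 1) / r) / (r + 1) + r * corrector \<eta> (r + 1) / (r + 1) + 2 / r)
        \<le> s * (corrector \<eta> r + \<eta>)"
      using corrector_drift[OF \<eta> r] s by (intro mult_left_mono) auto
    then show ?thesis
      unfolding A_eq h_def by (simp add: algebra_simps)
  qed
  have "A \<le> 1 / (r + 1) + r * 1 / (r + 1)"
    unfolding A_def using h[OF rr(1)] h[OF rr(2)] r
    by (intro add_mono divide_right_mono mult_left_mono) auto
  also have "\<dots> = 1"
    using r by (simp add: add_divide_distrib[symmetric])
  finally have A1: "A \<le> 1" .
  have A0: "0 \<le> A"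
    unfolding A_def using h[OF rr(1)] h[OF rr(2)] r by (intro add_nonneg_nonneg divide_nonneg_nonneg mult_nonneg_nonneg) auto
  have "ln ((r + 1) / r) \<le> (r + 1) / r - 1"
    using r by (intro ln_le_minus_one) auto
  then have l: "ln ((r + 1) / r) \<le> 1 / r"
    using r by (simp add: field_simps)
  have s1: "2 * s \<le> 1"
    using s \<eta> by linarith
  define z where "z = 2 * s / r"
  have z: "0 \<le> z" "z \<le> 1" "z \<le> 2 * s"
    using r s s1 by (auto simp: z_def field_simps intro: order_trans)
  have "g = exp (2 * s * ln ((r + 1) / r))"
    using r by (simp add: g_def powr_def)
  also have "\<dots> \<le> exp z"
    using mult_left_mono[OF l, of "2 * s"] s by (simp add: z_def)
  also have "\<dots> \<le> 1 + z + z\<^sup>2"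
    using z by (intro exp_bound) auto
  also have "z\<^sup>2 \<le> (2 * s)\<^sup>2"
    using z by (intro power_mono) auto
  finally have g: "g \<le> 1 + z + 4 * s\<^sup>2"
    by (simp add: power_mult_distrib)
  have "g * A \<le> (1 + z + 4 * s\<^sup>2) * A"
    using g A0 by (rule mult_right_mono)
  also have "\<dots> = A + (z + 4 * s\<^sup>2) * A"
    by (simp add: algebra_simps)
  also have "\<dots> \<le> A + (z + 4 * s\<^sup>2) * 1"
    using A1 z by (intro add_left_mono mult_left_mono) auto
  also have "\<dots> \<le> h r + s * \<eta> + 4 * s\<^sup>2"
    using \<open>A + s * (2 / r) \<le> h r + s * \<eta>\<close> by (simp add: z_def mult.commute)
  also have "4 * s\<^sup>2 \<le> s * \<eta>"
    using mult_left_mono[OF s(3), of s] s by (simp add: power2_eq_square mult_ac)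
  \<comment> \<open>As \<open>h r\<close> is at least \<open>1 / 2\<close>, the error
    \<open>2 * s * \<eta>\<close> becomes a relative one; hence the 4 in the growth factor.\<close>
  also have "h r + s * \<eta> + s * \<eta> = h r + 4 * s * \<eta> * (1 / 2)"
    by simp
  also have "\<dots> \<le> h r + 4 * s * \<eta> * h r"
    using h[OF r] s \<eta> by (intro add_left_mono mult_left_mono) auto
  finally have main: "g * A \<le> (1 + 4 * s * \<eta>) * h r"
    by (simp add: algebra_simps)
  have Y: "Y > 0" and r0: "r > 0"
    using le r by auto
  have mx: "max X (X + Y) = (r + 1) * Y" "min X (X + Y) = r * Y"
      "max (X + Y) Y = (r + 1) * Y" "min (X + Y) Y = Y" "max X Y = r * Y" "min X Y = Y"
    using Y r0 le unfolding X by (auto simp: algebra_simps)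
  have pw: "((r + 1) * Y) powr (2 * s) = g * (r * Y) powr (2 * s)"
    using Y r0 by (simp add: g_def powr_mult powr_divide)
  have quot: "(r + 1) * Y / (r * Y) = (r + 1) / r" "(r + 1) * Y / Y = r + 1"
    using Y by simp_all
  have e1: "farey_weight \<eta> s X (X + Y) = g * (r * Y) powr (2 * s) * h ((r + 1) / r) / (r * Y * ((r + 1) * Y))"
    unfolding farey_weight_def mx pw quot by (simp add: X h_def algebra_simps)
  have e2: "farey_weight \<eta> s (X + Y) Y = g * (r * Y) powr (2 * s) * h (r + 1) / ((r + 1) * Y * Y)"
    unfolding farey_weight_def mx pw quot by (simp add: X h_def algebra_simps)
  have e3: "farey_weight \<eta> s X Y = (r * Y) powr (2 * s) * h r / (r * Y * Y)"
    unfolding farey_weight_def mx using Y by (simp add: X h_def)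
  have "farey_weight \<eta> s X (X + Y) + farey_weight \<eta> s (X + Y) Y
      = (r * Y) powr (2 * s) / (r * Y * Y) * (g * A)"
  proof -
    have "g * B * h1 / (r * Y * (t * Y)) + g * B * h2 / (t * Y * Y)
        = B / (r * Y * Y) * (g * (h1 / t + r * h2 / t))" if "t \<noteq> 0" for B h1 h2 t
      using that Y r0 by (simp add: field_simps)
    then show ?thesis
      unfolding e1 e2 A_def using r0 by simp
  qed
  also have "\<dots> \<le> (r * Y) powr (2 * s) / (r * Y * Y) * ((1 + 4 * s * \<eta>) * h r)"
    using main Y r0 by (intro mult_left_mono) auto
  also have "\<dots> = (1 + 4 * s * \<eta>) * farey_weight \<eta> s X Y"
    unfolding e3 by simp
  finally show ?case
    using farey_weight_swap[of \<eta> s "X + Y"] farey_weight_swap[of \<eta> s X Y]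
    by (simp add: add.commute)
qed

text \<open>Removes the corrector at the cost of a factor 2; in particular the weight is
  positive.\<close>

lemma farey_weight_ge:
  assumes "0 < \<eta>" "0 < s" "s \<le> exp (- 3 / \<eta>) / 6" "0 < X" "0 < Y"
  shows "max X Y powr (2 * s) / (X * Y) \<le> 2 * farey_weight \<eta> s X Y"
proof -
  have "max X Y / min X Y \<ge> 1"
    using assms by auto
  then have "1 \<le> 2 * (1 + s * corrector \<eta> (max X Y / min X Y))"
    using corrector_small(1)[OF assms(1-3)] by fastforce
  then have "max X Y powr (2 * s) / (X * Y) * 1
      \<le> max X Y powr (2 * s) / (X * Y) * (2 * (1 + s * corrector \<eta> (max X Y / min X Y)))"
    using assms by (intro mult_left_mono) auto
  then show ?thesis
    by (simp add: farey_weight_def mult_ac del: distrib_left_numeral)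
qed

text \<open>The points \<open>(p + Y * x, q - X * x)\<close> run through the line \<open>X * P + Y * Q = 1\<close>, and a step of
  the algorithm replaces \<open>(X, Y)\<close> by one of its two children.\<close>

lemma emeasure_euclid_small_le:
  assumes \<eta>: "0 < \<eta>" "\<eta> \<le> 1" and s: "0 < s" "s \<le> exp (- 3 / \<eta>) / 6" "4 * s \<le> \<eta>"
    and XY: "0 < X" "0 < Y" "X * p + Y * q = 1" and "0 < \<delta>"
  shows "emeasure lborel {x. 0 \<le> p + Y * x \<and> 0 \<le> q - X * x \<and> euclid n (p + Y * x) (q - X * x) < \<delta>}
           \<le> ennreal (2 * (2 * \<delta>) powr (2 * s) * (1 + 4 * s * \<eta>) ^ n * farey_weight \<eta> s X Y)"
    (is "emeasure lborel (?S n p q X Y) \<le> ennreal (?b n X Y)")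
  using XY
proof (induction n arbitrary: p q X Y)
  case 0
  have w: "max X Y powr (2 * s) / (X * Y) \<le> 2 * farey_weight \<eta> s X Y"
    using farey_weight_ge[OF \<eta>(1) s(1,2) 0(1,2)] .
  show ?case
  \<comment> \<open>If both coordinates are below \<open>\<delta>\<close>, then
    \<open>X * P + Y * Q = 1\<close> forces \<open>2 * \<delta> * max X Y > 1\<close>. So either the
    set is empty, or it is bounded by the whole Farey interval and a power of a number at least 1
    may be inserted.\<close>
  proof (cases "2 * \<delta> * max X Y \<ge> 1")
    case True
    have "?S 0 p q X Y \<subseteq> {- p / Y .. q / X}"
      using 0 by (auto simp: field_simps)
    then have "emeasure lborel (?S 0 p q X Y) \<le> emeasure lborel {- p / Y .. q / X}"
      by (intro emeasure_mono) auto
    also have "\<dots> = ennreal (1 / (X * Y))"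
    proof -
      have "q / X - (- p / Y) = (X * p + Y * q) / (X * Y)"
        using 0(1,2) by (simp add: field_simps)
      then have "q / X - (- p / Y) = 1 / (X * Y)"
        using 0(3) by simp
      moreover from this have "- p / Y \<le> q / X"
        using 0(1,2) by (metis diff_ge_0_iff_ge divide_nonneg_pos less_eq_real_def mult_pos_pos zero_less_one)
      ultimately show ?thesis by (simp only: emeasure_lborel_Icc)
    qed
    also have "\<dots> \<le> ennreal (?b 0 X Y)"
    proof (rule ennreal_leI)
      have "1 * (1 / (X * Y)) \<le> (2 * \<delta> * max X Y) powr (2 * s) * (1 / (X * Y))"
        using True s 0 by (intro mult_right_mono ge_one_powr_ge_zero) auto
      also have "\<dots> = (2 * \<delta>) powr (2 * s) * (max X Y powr (2 * s) / (X * Y))"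
        using 0 \<open>0 < \<delta>\<close> by (simp add: powr_mult)
      also have "\<dots> \<le> (2 * \<delta>) powr (2 * s) * (2 * farey_weight \<eta> s X Y)"
        using w by (intro mult_left_mono) auto
      finally show "1 / (X * Y) \<le> ?b 0 X Y" by simp
    qed
    finally show ?thesis .
  next
    case False
    have "?S 0 p q X Y = {}"
    proof (rule ccontr)
      assume "?S 0 p q X Y \<noteq> {}"
      then obtain x where x: "0 \<le> p + Y * x" "0 \<le> q - X * x" "p + Y * x < \<delta>" "q - X * x < \<delta>"
        by auto
      have "1 = X * (p + Y * x) + Y * (q - X * x)"
        using 0(3) by (simp add: algebra_simps)
      also have "\<dots> \<le> max X Y * (p + Y * x) + max X Y * (q - X * x)"
        using x by (intro add_mono mult_right_mono) auto
      also have "\<dots> \<le> max X Y * \<delta> + max X Y * \<delta>"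
        using x 0 by (intro add_mono mult_left_mono) auto
      finally show False
        using False by (simp add: mult.commute)
    qed
    then show ?thesis by (simp only: emeasure_empty) simp
  qed
next
  case (Suc n)
  have meas: "?S n p q X Y \<in> sets lborel" for n p q X Y
  proof -
    have "closed {x. 0 \<le> p + Y * x}" "closed {x. 0 \<le> q - X * x}"
      by (intro closed_Collect_le continuous_intros)+
    moreover have "open {x. euclid n (p + Y * x) (q - X * x) < \<delta>}"
      by (intro open_Collect_less continuous_intros)
    ultimately show ?thesis
      by (simp add: Collect_conj_eq borel_closed borel_open sets.Int)
  qed
  \<comment> \<open>The larger coordinate decides the child, and the new data satisfy the equation
    of their own line. For \<open>?S2\<close> the algorithm lists the pair in the other
    order.\<close>
  let ?S1 = "?S n (p - q) q X (X + Y)" and ?S2 = "?S n p (q - p) (X + Y) Y"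
  have "?S (Suc n) p q X Y \<subseteq> ?S1 \<union> ?S2"
  proof
    fix x assume x: "x \<in> ?S (Suc n) p q X Y"
    show "x \<in> ?S1 \<union> ?S2"
    proof (cases "q - X * x \<le> p + Y * x")
      case True
      then have e: "\<bar>\<bar>p + Y * x\<bar> - \<bar>q - X * x\<bar>\<bar> = p - q + (X + Y) * x"
          "min \<bar>p + Y * x\<bar> \<bar>q - X * x\<bar> = q - X * x"
        using x by (auto simp: algebra_simps)
      show ?thesis
        using x True unfolding euclid_Suc mem_Collect_eq e Un_iff by (auto simp: algebra_simps)
    next
      case False
      then have e: "\<bar>\<bar>p + Y * x\<bar> - \<bar>q - X * x\<bar>\<bar> = q - p - (X + Y) * x"
          "min \<bar>p + Y * x\<bar> \<bar>q - X * x\<bar> = p + Y * x"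
        using x by (auto simp: algebra_simps)
      show ?thesis
        using x False unfolding euclid_Suc mem_Collect_eq e Un_iff euclid_swap[of _ "p + Y * x"]
        by (auto simp: algebra_simps)
    qed
  qed
  then have "emeasure lborel (?S (Suc n) p q X Y) \<le> emeasure lborel (?S1 \<union> ?S2)"
    using meas by (intro emeasure_mono sets.Un) auto
  also have "\<dots> \<le> emeasure lborel ?S1 + emeasure lborel ?S2"
    by (rule emeasure_subadditive[OF meas meas])
  also have "\<dots> \<le> ennreal (?b n X (X + Y)) + ennreal (?b n (X + Y) Y)"
    by (intro add_mono Suc.IH) (use Suc.prems in \<open>auto simp: algebra_simps\<close>)
  also have "\<dots> = ennreal (2 * (2 * \<delta>) powr (2 * s) * (1 + 4 * s * \<eta>) ^ n *
      (farey_weight \<eta> s X (X + Y) + farey_weight \<eta> s (X + Y) Y))"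
  proof -
    have "0 \<le> farey_weight \<eta> s A B" if "0 < A" "0 < B" for A B
      using farey_weight_ge[OF \<eta>(1) s(1,2) that] that
      by (smt (verit) divide_nonneg_pos mult_pos_pos powr_ge_zero)
    then show ?thesis
      using Suc.prems \<eta> s by (subst ennreal_plus[symmetric]) (auto simp: algebra_simps)
  qed
  also have "\<dots> \<le> ennreal (2 * (2 * \<delta>) powr (2 * s) * (1 + 4 * s * \<eta>) ^ n *
      ((1 + 4 * s * \<eta>) * farey_weight \<eta> s X Y))"
    using farey_weight_step[OF \<eta> s Suc.prems(1,2)] \<eta> s
    by (intro ennreal_leI mult_left_mono) auto
  also have "\<dots> = ennreal (?b (Suc n) X Y)"
    by (simp add: mult_ac)
  finally show ?case .
qed

section \<open>Almost every direction is contracted subexponentially\<close>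

definition slow :: "real \<Rightarrow> real \<Rightarrow> bool" where
  "slow p q \<longleftrightarrow> (\<forall>\<epsilon>>0. \<forall>\<^sub>F n in sequentially. exp (- \<epsilon> * real n) \<le> euclid n p q)"

lemma slowD: "slow p q \<Longrightarrow> \<epsilon> > 0 \<Longrightarrow> \<forall>\<^sub>F n in sequentially. exp (- \<epsilon> * real n) \<le> euclid n p q"
  unfolding slow_def by blast

text \<open>Countably many rates suffice, so the exceptional null sets can be united and slowness
  becomes a Borel condition.\<close>

lemma slow_iff_Suc:
  "slow p q \<longleftrightarrow> (\<forall>k. \<forall>\<^sub>F n in sequentially. exp (- (1 / Suc k) * real n) \<le> euclid n p q)"
proof
  assume "slow p q"
  then show "\<forall>k. \<forall>\<^sub>F n in sequentially. exp (- (1 / Suc k) * real n) \<le> euclid n p q"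
    by (intro allI slowD) simp_all
next
  assume *: "\<forall>k. \<forall>\<^sub>F n in sequentially. exp (- (1 / Suc k) * real n) \<le> euclid n p q"
  show "slow p q"
    unfolding slow_def
  proof (intro allI impI)
    fix \<epsilon> :: real assume "\<epsilon> > 0"
    then obtain k where k: "1 / Suc k < \<epsilon>"
      using nat_approx_posE by blast
    from spec[OF *, of k] show "\<forall>\<^sub>F n in sequentially. exp (- \<epsilon> * real n) \<le> euclid n p q"
    proof eventually_elim
      case (elim n)
      have "exp (- \<epsilon> * real n) \<le> exp (- (1 / Suc k) * real n)"
        using mult_right_mono[of "1 / Suc k" \<epsilon> "real n"] k by simp
      then show ?case using elim by linarith
    qed
  qed
qed

lemma slow_cong_abs: "\<bar>p\<bar> = \<bar>p'\<bar> \<Longrightarrow> \<bar>q\<bar> = \<bar>q'\<bar> \<Longrightarrow> slow p q \<longleftrightarrow> slow p' q'"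
  unfolding slow_def using euclid_cong_abs[of p p' q q'] by simp

text \<open>Half of the rate absorbs the constant. This allows passing from the segment of points
  \<open>(x, 1 - x)\<close> to the unit circle.\<close>

lemma slow_mult:
  assumes "slow p q" "c \<noteq> 0"
  shows "slow (c * p) (c * q)"
  unfolding slow_def
proof (intro allI impI)
  fix \<epsilon> :: real assume "\<epsilon> > 0"
  then have "(\<lambda>n. exp (- (\<epsilon> / 2)) ^ n) \<longlonglongrightarrow> 0"
    by (intro LIMSEQ_realpow_zero) auto
  then have "\<forall>\<^sub>F n in sequentially. exp (- (\<epsilon> / 2)) ^ n < \<bar>c\<bar>"
    using assms(2) by (intro order_tendstoD) auto
  moreover have "\<forall>\<^sub>F n in sequentially. exp (- (\<epsilon> / 2) * real n) \<le> euclid n p q"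
    using \<open>\<epsilon> > 0\<close> by (intro slowD[OF assms(1)]) simp
  ultimately show "\<forall>\<^sub>F n in sequentially. exp (- \<epsilon> * real n) \<le> euclid n (c * p) (c * q)"
  proof eventually_elim
    case (elim n)
    have "exp (- \<epsilon> * real n) = exp (- (\<epsilon> / 2)) ^ n * exp (- (\<epsilon> / 2) * real n)"
      by (simp add: exp_of_nat_mult[symmetric] exp_add[symmetric] mult.commute)
    also have "\<dots> \<le> \<bar>c\<bar> * euclid n p q"
      using elim by (intro mult_mono) auto
    finally show ?case by (simp add: euclid_mult)
  qed
qed

text \<open>Borel-Cantelli: at the threshold \<open>exp (- \<epsilon> * n)\<close> the measure bound
  is a constant times \<open>exp (- 2 * s * \<epsilon> * n)\<close> times a growth of at most
  \<open>exp (s * \<epsilon> * n)\<close>, which is summable.\<close>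

lemma AE_euclid_ge:
  assumes "\<epsilon> > 0"
  shows "AE x in lborel. 0 \<le> x \<and> x \<le> 1 \<longrightarrow>
           (\<forall>\<^sub>F n in sequentially. exp (- \<epsilon> * real n) \<le> euclid n x (1 - x))"
proof -
  \<comment> \<open>\<open>4 * \<eta> \<le> \<epsilon>\<close> keeps the growth factor at most
    \<open>exp (s * \<epsilon>)\<close>; \<open>s\<close> is then the largest value that the
    supersolution permits.\<close>
  define \<eta> where "\<eta> = min (\<epsilon> / 4) 1"
  have \<eta>: "0 < \<eta>" "\<eta> \<le> 1" "4 * \<eta> \<le> \<epsilon>"
    using assms by (auto simp: \<eta>_def)
  define s where "s = min (exp (- 3 / \<eta>) / 6) (\<eta> / 4)"
  have s: "0 < s" "s \<le> exp (- 3 / \<eta>) / 6" "4 * s \<le> \<eta>"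
    using \<eta> by (auto simp: s_def)
  define A where "A = (\<lambda>n. {x. 0 \<le> x \<and> 0 \<le> 1 - x \<and> euclid n x (1 - x) < exp (- \<epsilon> * real n)})"
  define C where "C = 2 * 2 powr (2 * s) * farey_weight \<eta> s 1 1"
  have C: "C \<ge> 0"
    using farey_weight_ge[OF \<eta>(1) s(1,2), of 1 1] by (simp add: C_def)
  have le: "emeasure lborel (A n) \<le> ennreal (C * exp (- s * \<epsilon>) ^ n)" for n
  proof -
    have "emeasure lborel (A n)
        \<le> ennreal (2 * (2 * exp (- \<epsilon> * real n)) powr (2 * s) * (1 + 4 * s * \<eta>) ^ n * farey_weight \<eta> s 1 1)"
      \<comment> \<open>The root \<open>X = Y = 1\<close> with \<open>p = 0\<close>,
        \<open>q = 1\<close> parametrizes the points \<open>(x, 1 - x)\<close>.\<close>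
      using emeasure_euclid_small_le[OF \<eta>(1,2) s, of 1 1 0 1 "exp (- \<epsilon> * real n)" n]
      by (simp add: A_def)
    moreover have "2 * (2 * exp (- \<epsilon> * real n)) powr (2 * s) * (1 + 4 * s * \<eta>) ^ n * farey_weight \<eta> s 1 1
        \<le> C * exp (- s * \<epsilon>) ^ n"
    proof -
      have "2 * (2 * exp (- \<epsilon> * real n)) powr (2 * s) * (1 + 4 * s * \<eta>) ^ n * farey_weight \<eta> s 1 1
        = C * (exp (- \<epsilon> * real n) powr (2 * s) * (1 + 4 * s * \<eta>) ^ n)"
      by (simp add: C_def powr_mult)
    also have "\<dots> \<le> C * (exp (- (2 * s * \<epsilon>)) ^ n * exp (s * \<epsilon>) ^ n)"
    proof (intro mult_left_mono mult_mono C)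
      have "1 + 4 * s * \<eta> \<le> 1 + s * \<epsilon>"
        using mult_left_mono[OF \<eta>(3), of s] s by simp
      also have "\<dots> \<le> exp (s * \<epsilon>)"
        by (rule exp_ge_add_one_self)
      finally show "(1 + 4 * s * \<eta>) ^ n \<le> exp (s * \<epsilon>) ^ n"
        using s \<eta> by (intro power_mono) auto
      show "exp (- \<epsilon> * real n) powr (2 * s) \<le> exp (- (2 * s * \<epsilon>)) ^ n"
        by (simp add: powr_def exp_of_nat_mult[symmetric] mult_ac)
    qed (use s \<eta> in auto)
    also have "\<dots> = C * exp (- s * \<epsilon>) ^ n"
      by (simp add: power_mult_distrib[symmetric] exp_add[symmetric] mult.commute)
      finally show ?thesis .
    qed
    ultimately show ?thesis
      by (meson ennreal_leI order_trans)
  qed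
  have meas: "A n \<in> sets lborel" for n
  proof -
    have "open {x. euclid n x (1 - x) < exp (- \<epsilon> * real n)}"
      by (intro open_Collect_less continuous_intros)
    moreover have "A n = {0..1} \<inter> {x. euclid n x (1 - x) < exp (- \<epsilon> * real n)}"
      by (auto simp: A_def)
    ultimately show ?thesis
      by (simp add: borel_open sets.Int)
  qed
  have "AE x in lborel. \<forall>\<^sub>F n in sequentially. x \<in> space lborel - A n"
  proof (rule borel_cantelli_AE1[OF meas])
    show "emeasure lborel (A n) < \<infinity>" for n
      using le[of n] by (rule le_less_trans) simp
    show "summable (\<lambda>n. measure lborel (A n))"
    proof (rule summable_comparison_test')
      show "summable (\<lambda>n. C * exp (- s * \<epsilon>) ^ n)"
        using s assms by (intro summable_mult summable_geometric) simp
      show "norm (measure lborel (A n)) \<le> C * exp (- s * \<epsilon>) ^ n" for n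
        using le[of n] C by (simp add: measure_def enn2real_leI)
    qed
  qed
  then show ?thesis
  proof (rule AE_mp, intro AE_I2 impI)
    fix x :: real
    assume *: "\<forall>\<^sub>F n in sequentially. x \<in> space lborel - A n" and x: "0 \<le> x \<and> x \<le> 1"
    from * show "\<forall>\<^sub>F n in sequentially. exp (- \<epsilon> * real n) \<le> euclid n x (1 - x)"
      by eventually_elim (use x in \<open>auto simp: A_def not_less\<close>)
  qed
qed

text \<open>The open first quadrant is a differentiable image of the segment, so null sets stay
  null; the second is its reflection, as slowness ignores signs; the axes contribute two
  angles.\<close>

lemma AE_slow_angle: "AE \<theta> in lebesgue_on {0..<pi}. slow (cos \<theta>) (sin \<theta>)"
proof -
  \<comment> \<open>The end points are left out: they give the axes, and \<open>\<phi>\<close> below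
    divides by \<open>x\<close>.\<close>
  define N where "N = {x. 0 < x \<and> x < 1 \<and> \<not> slow x (1 - x)}"
  have "AE x in lborel. 0 \<le> x \<and> x \<le> 1 \<longrightarrow> slow x (1 - x)"
  proof -
    have "AE x in lborel. \<forall>k. 0 \<le> x \<and> x \<le> 1 \<longrightarrow>
        (\<forall>\<^sub>F n in sequentially. exp (- (1 / Suc k) * real n) \<le> euclid n x (1 - x))"
      unfolding AE_all_countable by (intro allI AE_euclid_ge) simp
    then show ?thesis
      unfolding slow_iff_Suc by eventually_elim blast
  qed
  then have "AE x in lebesgue. x \<notin> N"
    by (intro AE_completion) (auto simp: N_def elim: eventually_mono)
  then have N: "negligible N"
    by (auto simp: eventually_ae_filter simp flip: negligible_iff_null_sets intro: negligible_subset)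
  \<comment> \<open>The angle of the direction \<open>(x, 1 - x)\<close>.\<close>
  define \<phi> where "\<phi> = (\<lambda>x::real. arctan ((1 - x) / x))"
  have "\<phi> differentiable_on N"
    unfolding differentiable_on_def
  proof
    fix x assume "x \<in> N"
    then have "x \<noteq> 0" by (auto simp: N_def)
    then have "(\<phi> has_real_derivative ((- 1) * x - (1 - x) * 1) / (x * x) * inverse (1 + ((1 - x) / x)\<^sup>2)) (at x)"
      unfolding \<phi>_def by (auto intro!: derivative_eq_intros)
    then show "\<phi> differentiable at x within N"
      using real_differentiable_def differentiable_at_withinI by blast
  qed
  then have N1: "negligible (\<phi> ` N)"
    using N by (intro negligible_differentiable_image_negligible) auto
  have N2: "negligible ((\<lambda>t. pi - t) ` \<phi> ` N)"
    by (rule negligible_differentiable_image_negligible[OF order_refl N1]) (auto intro!: derivative_intros)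
  have first: "\<theta> \<in> \<phi> ` N" if \<theta>: "0 < \<theta>" "\<theta> < pi / 2" "\<not> slow (cos \<theta>) (sin \<theta>)" for \<theta>
  proof -
    have c: "cos \<theta> > 0" "sin \<theta> > 0"
      using \<theta> by (auto intro: cos_gt_zero sin_gt_zero)
    define r where "r = cos \<theta> + sin \<theta>"
    define x where "x = cos \<theta> / r"
    have r: "r > 0" and x: "0 < x" "x < 1" "1 - x = sin \<theta> / r"
      using c by (auto simp: r_def x_def field_simps)
    have "\<phi> x = arctan (tan \<theta>)"
      using c r unfolding \<phi>_def x(3) by (simp add: x_def tan_def)
    then have "\<phi> x = \<theta>"
      using \<theta> by (simp add: arctan_tan)
    moreover have "\<not> slow x (1 - x)"
    proof
      assume "slow x (1 - x)"
      from slow_mult[OF this, of r] have "slow (cos \<theta>) (sin \<theta>)"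
        using r unfolding x(3) by (simp add: x_def)
      with \<theta>(3) show False ..
    qed
    ultimately show ?thesis
      using x unfolding N_def by blast
  qed
  have "\<theta> \<in> \<phi> ` N \<union> (\<lambda>t. pi - t) ` \<phi> ` N \<union> {0, pi / 2}"
    if \<theta>: "\<theta> \<in> {0..<pi}" "\<not> slow (cos \<theta>) (sin \<theta>)" for \<theta>
  proof -
    consider "\<theta> \<in> {0, pi / 2}" | "0 < \<theta>" "\<theta> < pi / 2" | "pi / 2 < \<theta>"
      using \<theta> by fastforce
    then show ?thesis
    proof cases
      case 3
      have "\<not> slow (cos (pi - \<theta>)) (sin (pi - \<theta>))"
        using \<theta>(2) slow_cong_abs[of "cos (pi - \<theta>)" "cos \<theta>" "sin (pi - \<theta>)" "sin \<theta>"] by simp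
      then have "pi - \<theta> \<in> \<phi> ` N"
        using first[of "pi - \<theta>"] 3 \<theta>(1) by simp
      then show ?thesis
        by (metis Un_iff diff_diff_eq2 add_diff_cancel_left' image_eqI)
    qed (use first \<theta> in auto)
  qed
  moreover have "negligible (\<phi> ` N \<union> (\<lambda>t. pi - t) ` \<phi> ` N \<union> {0, pi / 2})"
    using N1 N2 by (intro negligible_Un) auto
  ultimately have "AE \<theta> in lebesgue. \<theta> \<in> {0..<pi} \<longrightarrow> slow (cos \<theta>) (sin \<theta>)"
    unfolding negligible_iff_null_sets by (intro AE_I') (assumption, blast)
  then show ?thesis
    by (subst AE_restrict_space_iff) auto
qed

section \<open>Transfer from angles to the circle\<close>

lemma circle_pt_eq_abs:
  assumes "circle_pt s = circle_pt t"
  shows "\<bar>cos s\<bar> = \<bar>cos t\<bar>" "\<bar>sin s\<bar> = \<bar>sin t\<bar>"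
proof -
  obtain k :: int where "s - t = of_int k * pi"
    using assms circle_pt_eq_iff by blast
  then have 0: "sin (s - t) = 0"
    using sin_zero_iff_int2 by blast
  then have 1: "\<bar>cos (s - t)\<bar> = 1"
    by (rule sin_zero_abs_cos_one)
  have "cos s = cos (t + (s - t))" "sin s = sin (t + (s - t))"
    by simp_all
  then have "cos s = cos t * cos (s - t)" "sin s = sin t * cos (s - t)"
    unfolding cos_add sin_add 0 by simp_all
  then show "\<bar>cos s\<bar> = \<bar>cos t\<bar>" "\<bar>sin s\<bar> = \<bar>sin t\<bar>"
    using 1 by (simp_all add: abs_mult)
qed

text \<open>Pushing the statement forward requires a Borel condition on the circle. The sets
  \<open>D k n\<close> are open and, as \<open>euclid\<close> ignores signs, unions of fibres of
  \<open>circle_pt\<close>, so their images are open in the quotient topology.\<close>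

lemma AE_slow: "AE x in circle_lebesgue. \<exists>\<theta>. x = circle_pt \<theta> \<and> slow (cos \<theta>) (sin \<theta>)"
proof -
  define D where "D = (\<lambda>k n. {t. euclid n (cos t) (sin t) < exp (- (1 / Suc k) * real n)})"
  have iff: "circle_pt t \<in> circle_pt ` D k n \<longleftrightarrow> t \<in> D k n" for k n t
  proof
    assume "circle_pt t \<in> circle_pt ` D k n"
    then obtain u where u: "circle_pt t = circle_pt u" "u \<in> D k n" by blast
    then show "t \<in> D k n"
      using euclid_cong_abs[OF circle_pt_eq_abs[OF u(1)]] by (simp add: D_def)
  qed blast
  have "open (D k n)" for k n
    unfolding D_def by (intro open_Collect_less continuous_intros)
  then have "open (circle_pt ` D k n)" for k n
    unfolding open_rp1_def vimage_def iff by simp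
  then have [measurable]: "circle_pt ` D k n \<in> sets borel" for k n
    by (rule borel_open)
  have slow: "slow (cos t) (sin t) \<longleftrightarrow> (\<forall>k. \<exists>N. \<forall>n\<ge>N. circle_pt t \<notin> circle_pt ` D k n)" for t
    unfolding slow_iff_Suc eventually_sequentially iff by (simp add: D_def not_less)
  have "AE x in circle_lebesgue. \<forall>k. \<exists>N. \<forall>n\<ge>N. x \<notin> circle_pt ` D k n"
    unfolding circle_lebesgue_def
    by (subst AE_distr_iff[OF measurable_circle_pt])
       (use AE_slow_angle in \<open>simp_all add: slow[symmetric]\<close>)
  then show ?thesis
  proof eventually_elim
    case (elim x)
    obtain t where "x = circle_pt t"
      using surj_circle_pt by (metis surjD)
    moreover from this have "slow (cos t) (sin t)"
      using elim unfolding slow by simp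
    ultimately show ?case by blast
  qed
qed

section \<open>The modular group\<close>

lemma pm_mat_in_carrier: "a * d - b * c = 1 \<Longrightarrow> pm_mat a b c d \<in> carrier PSL2Z"
  unfolding carrier_PSL2Z by blast

lemma one_PSL2Z: "one PSL2Z = pm_mat 1 0 0 1"
proof -
  have "(mat 1 :: int^2^2) = vector [vector [1, 0], vector [0, 1]]"
    by (simp add: vec_eq_iff forall_2 mat_def)
  then show ?thesis
    unfolding PSL2Z_def pm_mat_def by simp
qed

lemma mult_PSL2Z:
  "monoid.mult PSL2Z (pm_mat a b c d) (pm_mat a' b' c' d') =
     pm_mat (a * a' + b * c') (a * b' + b * d') (c * a' + d * c') (c * b' + d * d')"
proof -
  let ?A = "vector [vector [a, b], vector [c, d]] :: int^2^2"
  let ?B = "vector [vector [a', b'], vector [c', d']] :: int^2^2"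
  have prod: "?A ** ?B = vector [vector [a * a' + b * c', a * b' + b * d'],
      vector [c * a' + d * c', c * b' + d * d']]"
    by (simp add: vec_eq_iff forall_2 matrix_matrix_mult_def sum_2)
  have neg: "(- A) ** B = - (A ** B)" "A ** (- B) = - (A ** B)" for A B :: "int^2^2"
    by (simp_all add: vec_eq_iff matrix_matrix_mult_def sum_negf)
  have "monoid.mult PSL2Z {A, - A} {B, - B} = {A ** B, - (A ** B)}" for A B
    unfolding PSL2Z_def mult_FactGroup set_mult_def SL2Z_def by (auto simp: neg)
  from this[of ?A ?B] show ?thesis
    unfolding pm_mat_def prod .
qed

lemma circle_deriv_psl_act:
  assumes "a * d - b * c = 1"
  shows "circle_deriv (psl_act (pm_mat a b c d)) (circle_pt \<theta>) =
    1 / ((of_int a * cos \<theta> + of_int b * sin \<theta>)\<^sup>2 + (of_int c * cos \<theta> + of_int d * sin \<theta>)\<^sup>2)"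
  using has_circle_deriv_psl_act[OF assms] by (rule circle_deriv_eq)

lemma cos_sin_nonzero: "cos t \<noteq> 0 \<or> sin (t :: real) \<noteq> 0"
  using sin_zero_abs_cos_one[of t] by auto

lemma image_cos_sin_nonzero:
  assumes "a * d - b * c = 1"
  shows "of_int a * cos t + of_int b * sin t \<noteq> 0 \<or> of_int c * cos t + of_int d * sin (t :: real) \<noteq> 0"
proof -
  have "real_of_int a * of_int d - of_int b * of_int c = 1"
    using assms by (metis of_int_1 of_int_diff of_int_mult)
  then have "of_int d * (of_int a * cos t + of_int b * sin t) - of_int b * (of_int c * cos t + of_int d * sin t) = cos t"
      "of_int a * (of_int c * cos t + of_int d * sin t) - of_int c * (of_int a * cos t + of_int b * sin t) = sin t"
    by algebra+
  then show ?thesis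
    using cos_sin_nonzero[of t] by auto
qed

section \<open>Derivatives along words and the Lyapunov exponent\<close>

text \<open>The derivative is \<open>1 / (P\<^sup>2 + Q\<^sup>2)\<close>, and the delay at
  \<open>m = 0\<close> bounds the larger of \<open>|P|\<close> and \<open>|Q|\<close> from below by
  what \<open>L\<close> steps of the algorithm leave.\<close>

lemma ln_circle_deriv_le:
  assumes "a * d - b * c = 1" "delay L a b c d"
  shows "ln (circle_deriv (psl_act (pm_mat a b c d)) (circle_pt \<theta>)) \<le> - 2 * ln (euclid L (cos \<theta>) (sin \<theta>))"
proof -
  define P where "P = of_int a * cos \<theta> + of_int b * sin \<theta>"
  define Q where "Q = of_int c * cos \<theta> + of_int d * sin \<theta>"
  define E where "E = euclid L (cos \<theta>) (sin \<theta>)"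
  have E: "E > 0"
    unfolding E_def by (rule euclid_pos) (rule cos_sin_nonzero)
  have "E \<le> max \<bar>P\<bar> \<bar>Q\<bar>"
    using assms(2) unfolding delay_def E_def P_def Q_def by (metis add_0 euclid.simps(1))
  then have "E \<le> \<bar>P\<bar> \<or> E \<le> \<bar>Q\<bar>" by auto
  then have "E\<^sup>2 \<le> P\<^sup>2 \<or> E\<^sup>2 \<le> Q\<^sup>2"
    using E by (metis abs_of_pos abs_le_square_iff)
  moreover have "0 \<le> P\<^sup>2" "0 \<le> Q\<^sup>2" by simp_all
  ultimately have le: "E\<^sup>2 \<le> P\<^sup>2 + Q\<^sup>2"
    by linarith
  have "2 * ln E = ln (E\<^sup>2)"
    using E by (simp add: ln_realpow)
  also have "\<dots> \<le> ln (P\<^sup>2 + Q\<^sup>2)"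
    using le E by (smt (verit) ln_le_cancel_iff zero_less_power)
  finally have "- ln (P\<^sup>2 + Q\<^sup>2) \<le> - 2 * ln E"
    by simp
  moreover have "P\<^sup>2 + Q\<^sup>2 > 0"
    using image_cos_sin_nonzero[OF assms(1), of \<theta>] by (simp add: P_def Q_def sum_power2_gt_zero_iff)
  ultimately show ?thesis
    unfolding circle_deriv_psl_act[OF assms(1)] P_def[symmetric] Q_def[symmetric] E_def[symmetric]
    by (auto simp: ln_div)
qed

lemma word_prod_delay:
  assumes "finite F" "F \<subseteq> carrier PSL2Z"
  shows "\<exists>K\<ge>1. \<forall>ws. set ws \<subseteq> F \<longrightarrow> (\<exists>a b c d. word_prod PSL2Z ws = pm_mat a b c d \<and>
           a * d - b * c = 1 \<and> delay (K * length ws) a b c d)"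
proof -
  have "\<forall>f\<in>F. \<exists>K a b c d. f = pm_mat a b c d \<and> a * d - b * c = 1 \<and> delay K a b c d"
  proof
    fix f assume "f \<in> F"
    then obtain a b c d where "f = pm_mat a b c d" "a * d - b * c = 1"
      using assms(2) unfolding carrier_PSL2Z by blast
    moreover from this obtain K where "delay K a b c d"
      using ex_delay_det[of a d b c] by auto
    ultimately show "\<exists>K a b c d. f = pm_mat a b c d \<and> a * d - b * c = 1 \<and> delay K a b c d"
      by blast
  qed
  then obtain k where k:
    "\<forall>f\<in>F. \<exists>a b c d. f = pm_mat a b c d \<and> a * d - b * c = 1 \<and> delay (k f) a b c d"
    by metis
  \<comment> \<open>The sum dominates each \<open>k f\<close>; \<open>Suc\<close> makes
    \<open>K\<close> positive, so that \<open>K * n\<close> will tend to infinity with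
    \<open>n\<close>.\<close>
  define K where "K = Suc (sum k F)"
  have "\<exists>a b c d. word_prod PSL2Z ws = pm_mat a b c d \<and> a * d - b * c = 1 \<and> delay (K * length ws) a b c d"
    if "set ws \<subseteq> F" for ws
    using that
  proof (induction ws)
    case Nil
    show ?case
      using delay_sign[of 1 1]
      by (intro exI[of _ 1] exI[of _ 0]) (simp add: word_prod_def one_PSL2Z)
  next
    case (Cons f ws)
    then obtain a' b' c' d' where ws: "word_prod PSL2Z ws = pm_mat a' b' c' d'" "a' * d' - b' * c' = 1"
        "delay (K * length ws) a' b' c' d'"
      by auto
    obtain a b c d where f: "f = pm_mat a b c d" "a * d - b * c = 1" "delay (k f) a b c d"
      using k Cons.prems by auto
    have "k f \<le> K"
      using Cons.prems assms(1) member_le_sum[of f F k] by (simp add: K_def)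
    then have "delay K a b c d"
      using f(3) by (rule delay_mono[rotated])
    from delay_mult[OF this ws(3)]
    have "delay (K * length (f # ws)) (a * a' + b * c') (a * b' + b * d') (c * a' + d * c') (c * b' + d * d')"
      by simp
    moreover have "word_prod PSL2Z (f # ws) =
        pm_mat (a * a' + b * c') (a * b' + b * d') (c * a' + d * c') (c * b' + d * d')"
      using ws(1) f(1) by (simp add: word_prod_def mult_PSL2Z)
    moreover have "(a * a' + b * c') * (c * b' + d * d') - (a * b' + b * d') * (c * a' + d * c')
        = (a * d - b * c) * (a' * d' - b' * c')"
      by (simp add: algebra_simps)
    ultimately show ?case
      using ws(2) f(2) by (metis mult_1)
  qed
  then show ?thesis
    by (intro exI[of _ K]) (simp add: K_def)
qed

text \<open>A squeeze: the maximum is at least 0, the value at the identity, and at most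
  \<open>- 2 * ln (E (K * n)) / n\<close>, which becomes arbitrarily small in a slow
  direction.\<close>

lemma lyapunov_exp_eq_0:
  assumes F: "finite F" "generates_semigroup PSL2Z F" and slow: "slow (cos \<theta>) (sin \<theta>)"
  shows "lyapunov_exp PSL2Z psl_act F (circle_pt \<theta>) = 0"
proof -
  have sub: "F \<subseteq> carrier PSL2Z"
    using F(2) by (simp add: generates_semigroup_def)
  obtain K where K: "K \<ge> 1" "\<And>ws. set ws \<subseteq> F \<Longrightarrow> \<exists>a b c d. word_prod PSL2Z ws = pm_mat a b c d \<and>
           a * d - b * c = 1 \<and> delay (K * length ws) a b c d"
    using word_prod_delay[OF F(1) sub] by blast
  define E where "E = (\<lambda>n. euclid n (cos \<theta>) (sin \<theta>))"
  have E: "E n > 0" for n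
    unfolding E_def by (rule euclid_pos) (rule cos_sin_nonzero)
  define B where "B = (\<lambda>n. {g \<in> carrier PSL2Z. word_length PSL2Z F g \<le> n})"
  \<comment> \<open>Generation makes the set under \<open>LEAST\<close> nonempty, so the word length
    is attained by an actual word.\<close>
  have B: "\<exists>ws. set ws \<subseteq> F \<and> length ws \<le> n \<and> word_prod PSL2Z ws = g" if "g \<in> B n" for g n
  proof -
    have "\<exists>m ws. set ws \<subseteq> F \<and> length ws = m \<and> word_prod PSL2Z ws = g"
      using that F(2) unfolding B_def generates_semigroup_def by blast
    then have "\<exists>ws. set ws \<subseteq> F \<and> length ws = word_length PSL2Z F g \<and> word_prod PSL2Z ws = g"
      unfolding word_length_def by (rule LeastI_ex)
    then show ?thesis
      using that unfolding B_def by auto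
  qed
  have fin: "finite (B n)" for n
  proof (rule finite_subset)
    show "B n \<subseteq> word_prod PSL2Z ` {ws. set ws \<subseteq> F \<and> length ws \<le> n}"
      using B by blast
    show "finite (word_prod PSL2Z ` {ws. set ws \<subseteq> F \<and> length ws \<le> n})"
      using F(1) by (intro finite_imageI finite_lists_length_le)
  qed
  have one: "one PSL2Z \<in> B n" for n
  proof -
    have "word_length PSL2Z F (one PSL2Z) = 0"
      unfolding word_length_def by (rule Least_eq_0) (auto simp: word_prod_def)
    then show ?thesis
      by (simp add: B_def one_PSL2Z pm_mat_in_carrier)
  qed
  define f where "f = (\<lambda>n g. (1 / real n) * ln (circle_deriv (psl_act g) (circle_pt \<theta>)))"
  have f1: "f n (one PSL2Z) = 0" for n
    unfolding f_def one_PSL2Z by (subst circle_deriv_psl_act) auto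
  have lower: "0 \<le> Max (f n ` B n)" for n
    using fin one f1 by (metis Max_ge finite_imageI image_eqI)
  have upper: "Max (f n ` B n) \<le> (1 / real n) * (- 2 * ln (E (K * n)))" for n
  proof (intro Max.boundedI)
    show "finite (f n ` B n)" "f n ` B n \<noteq> {}"
      using fin one by auto
    fix y assume "y \<in> f n ` B n"
    then obtain g where g: "g \<in> B n" "y = f n g" by blast
    then obtain ws where ws: "set ws \<subseteq> F" "length ws \<le> n" "word_prod PSL2Z ws = g"
      using B by blast
    then obtain a b c d where abcd: "g = pm_mat a b c d" "a * d - b * c = 1" "delay (K * length ws) a b c d"
      using K(2) by metis
    have "delay (K * n) a b c d"
      using abcd(3) ws(2) by (intro delay_mono[OF abcd(3)] mult_le_mono2)
    then show "y \<le> (1 / real n) * (- 2 * ln (E (K * n)))"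
      unfolding g(2) f_def E_def abcd(1) by (intro mult_left_mono ln_circle_deriv_le abcd(2)) auto
  qed
  have "(\<lambda>n. Max (f n ` B n)) \<longlonglongrightarrow> 0"
  proof (rule tendstoI)
    fix e :: real assume e: "e > 0"
    \<comment> \<open>Chosen so that \<open>2 * \<epsilon> * K * n = e / 2 * n\<close>.\<close>
    define \<epsilon> where "\<epsilon> = e / (4 * real K)"
    have \<epsilon>: "\<epsilon> > 0"
      using e K(1) by (simp add: \<epsilon>_def)
    have lim: "filterlim (\<lambda>n. K * n) sequentially sequentially"
      using K(1) by (intro filterlim_subseq) (simp add: strict_mono_def)
    have "\<forall>\<^sub>F n in sequentially. exp (- \<epsilon> * real (K * n)) \<le> E (K * n)"
      using eventually_compose_filterlim[OF slowD[OF slow \<epsilon>] lim] by (simp add: E_def)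
    then show "\<forall>\<^sub>F n in sequentially. dist (Max (f n ` B n)) 0 < e"
      using eventually_gt_at_top[of 0]
    proof eventually_elim
      case (elim n)
      have "- \<epsilon> * real (K * n) \<le> ln (E (K * n))"
        using elim(1) E by (simp add: ln_ge_iff)
      then have "- 2 * ln (E (K * n)) \<le> e / 2 * n"
        using K(1) by (simp add: \<epsilon>_def field_simps)
      then have "(1 / real n) * (- 2 * ln (E (K * n))) \<le> e / 2"
        using elim(2) by (simp add: field_simps)
      then show ?case
        using upper[of n] lower[of n] e by (simp add: dist_real_def)
    qed
  qed
  then have "(\<lambda>n. ereal (Max (f n ` B n))) \<longlonglongrightarrow> 0"
    by (simp add: zero_ereal_def)
  then have "limsup (\<lambda>n. ereal (Max (f n ` B n))) = 0"
    by (intro lim_imp_Limsup) auto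
  then show ?thesis
    unfolding lyapunov_exp_def f_def B_def .
qed

section \<open>Non-expandable points and minimality\<close>

lemma infinity_pt_iff: "circle_pt t = infinity_pt \<longleftrightarrow> sin t = 0"
  unfolding circle_pt_def infinity_pt_def using cos_sin_nonzero[of t]
  by (subst line_through_eq_iff) (auto simp: unit_vec_nonzero vec_eq_iff forall_2)

lemma affine_pt_iff: "circle_pt t = affine_pt x \<longleftrightarrow> cos t = x * sin t"
  unfolding circle_pt_def affine_pt_def using cos_sin_nonzero[of t]
  by (subst line_through_eq_iff) (auto simp: unit_vec_nonzero vec_eq_iff forall_2 mult.commute)

lemma psl_act_circle_pt_eq_iff:
  assumes "a * d - b * c = 1"
  shows "psl_act (pm_mat a b c d) (circle_pt t) = circle_pt t \<longleftrightarrow>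
    (of_int a * cos t + of_int b * sin t) * sin t = (of_int c * cos t + of_int d * sin t) * cos t"
proof -
  have act: "psl_act (pm_mat a b c d) (line_through (vector [cos t, sin t])) =
      line_through (vector [of_int a * cos t + of_int b * sin t, of_int c * cos t + of_int d * sin t])"
    unfolding psl_act_line_through[OF assms unit_vec_nonzero] by simp
  show ?thesis
    unfolding circle_pt_def act using image_cos_sin_nonzero[OF assms, of t] cos_sin_nonzero[of t]
    by (subst line_through_eq_iff) (auto simp: vec_eq_iff forall_2)
qed

lemma NE_iff:
  "circle_pt t \<in> NE PSL2Z psl_act \<longleftrightarrow> (\<forall>a b c d. a * d - b * c = 1 \<longrightarrow>
     1 \<le> (of_int a * cos t + of_int b * sin t)\<^sup>2 + (of_int c * cos t + of_int d * sin t)\<^sup>2)"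
proof -
  have pos: "(of_int a * cos t + of_int b * sin t)\<^sup>2 + (of_int c * cos t + of_int d * sin t)\<^sup>2 > 0"
    if "a * d - b * c = 1" for a b c d :: int
    using image_cos_sin_nonzero[OF that, of t] by (simp add: sum_power2_gt_zero_iff)
  have "circle_deriv (psl_act (pm_mat a b c d)) (circle_pt t) \<le> 1 \<longleftrightarrow>
      1 \<le> (of_int a * cos t + of_int b * sin t)\<^sup>2 + (of_int c * cos t + of_int d * sin t)\<^sup>2"
    if "a * d - b * c = 1" for a b c d
    unfolding circle_deriv_psl_act[OF that] using pos[OF that] by simp
  then show ?thesis
    unfolding NE_def carrier_PSL2Z by blast
qed

text \<open>Off the axes, the upper shears force \<open>2 * |C| \<le> |S|\<close> and the lower ones
  \<open>2 * |S| \<le> |C|\<close>, a contradiction. On an axis the image vector is, up to sign, a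
  column of an integer matrix of determinant 1, hence nonzero and of length at least 1.\<close>

lemma NE_PSL2Z_iff: "circle_pt t \<in> NE PSL2Z psl_act \<longleftrightarrow> cos t = 0 \<or> sin t = 0"
proof
  assume "circle_pt t \<in> NE PSL2Z psl_act"
  then have NE: "1 \<le> (of_int a * cos t + of_int b * sin t)\<^sup>2 + (of_int c * cos t + of_int d * sin t)\<^sup>2"
    if "a * d - b * c = 1" for a b c d
    using that unfolding NE_iff by blast
  define C where "C = cos t"
  define S where "S = sin t"
  have one: "C * C + S * S = 1"
    unfolding C_def S_def power2_eq_square[symmetric] by simp
  note NE' = NE[folded C_def S_def]
  show "cos t = 0 \<or> sin t = 0"
  proof (rule ccontr)
    assume nz: "\<not> (cos t = 0 \<or> sin t = 0)"
    have "2 * \<bar>C\<bar> * \<bar>S\<bar> \<le> \<bar>S\<bar> * \<bar>S\<bar>"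
      \<comment> \<open>The order of instantiation is \<open>a d b c\<close>: these are the upper
        shears with \<open>b = 1\<close> and \<open>b = -1\<close>.\<close>
      using NE'[of 1 1 1 0] NE'[of 1 1 "-1" 0] one
      by (simp add: power2_eq_square algebra_simps abs_mult[symmetric] abs_if)
    then have "2 * \<bar>C\<bar> \<le> \<bar>S\<bar>"
      by (rule mult_right_le_imp_le) (use nz in \<open>simp add: S_def\<close>)
    have "2 * \<bar>S\<bar> * \<bar>C\<bar> \<le> \<bar>C\<bar> * \<bar>C\<bar>"
      using NE'[of 1 1 0 1] NE'[of 1 1 0 "-1"] one
      by (simp add: power2_eq_square algebra_simps abs_mult[symmetric] abs_if)
    then have "2 * \<bar>S\<bar> \<le> \<bar>C\<bar>"
      by (rule mult_right_le_imp_le) (use nz in \<open>simp add: C_def\<close>)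
    moreover have "\<bar>C\<bar> > 0"
      using nz by (simp add: C_def)
    ultimately show False
      using \<open>2 * \<bar>C\<bar> \<le> \<bar>S\<bar>\<close> by linarith
  qed
next
  assume "cos t = 0 \<or> sin t = 0"
  then have cs: "cos t = 0 \<and> (sin t)\<^sup>2 = 1 \<or> sin t = 0 \<and> (cos t)\<^sup>2 = 1"
    by (metis add.right_neutral add_0 sin_cos_squared_add zero_power2)
  have int: "1 \<le> (real_of_int m)\<^sup>2 + (real_of_int n)\<^sup>2" if "m \<noteq> 0 \<or> n \<noteq> 0" for m n
  proof -
    have "0 < m\<^sup>2 + n\<^sup>2"
      using that by (simp only: sum_power2_gt_zero_iff)
    then have "1 \<le> m\<^sup>2 + n\<^sup>2" by simp
    then have "real_of_int 1 \<le> real_of_int (m\<^sup>2 + n\<^sup>2)"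
      by (simp only: of_int_le_iff)
    then show ?thesis by simp
  qed
  show "circle_pt t \<in> NE PSL2Z psl_act"
    unfolding NE_iff
  proof (intro allI impI)
    fix a b c d :: int
    assume det: "a * d - b * c = 1"
    then have "a \<noteq> 0 \<or> c \<noteq> 0" "b \<noteq> 0 \<or> d \<noteq> 0" by auto
    then show "1 \<le> (of_int a * cos t + of_int b * sin t)\<^sup>2 + (of_int c * cos t + of_int d * sin t)\<^sup>2"
      using cs int[of a c] int[of b d] by (auto simp: power_mult_distrib)
  qed
qed

section \<open>Minimality\<close>

lemma continuous_on_affine_pt: "continuous_on UNIV affine_pt"
proof -
  have "affine_pt x = circle_pt (pi / 2 - arctan x)" for x
    by (simp add: eq_commute[of "affine_pt x"] affine_pt_iff cos_diff sin_diff sin_arctan cos_arctan)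
  then have eq: "affine_pt = (\<lambda>x. circle_pt (pi / 2 - arctan x))"
    by auto
  show ?thesis
    unfolding eq
    by (rule continuous_on_compose2[OF continuous_on_circle_pt]) (auto intro!: continuous_intros)
qed

text \<open>If \<open>A\<close> maps infinity to a rational point, then \<open>A (y + n)\<close> tends to that point for every
  \<open>y\<close>, so every orbit accumulates at every rational point.\<close>

lemma minimal_action_PSL2Z: "minimal_action PSL2Z psl_act"
  unfolding minimal_action_def
proof (intro allI)
  fix x
  show "closure (orbit PSL2Z psl_act x) = UNIV"
  proof (rule ccontr)
    assume "closure (orbit PSL2Z psl_act x) \<noteq> UNIV"
    define U where "U = - closure (orbit PSL2Z psl_act x)"
    have U: "open U" "U \<noteq> {}"
      using \<open>closure _ \<noteq> UNIV\<close> by (auto simp: U_def)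
    have disj: "psl_act (pm_mat a b c d) x \<notin> U" if "a * d - b * c = 1" for a b c d
    proof -
      have "psl_act (pm_mat a b c d) x \<in> orbit PSL2Z psl_act x"
        unfolding orbit_def using pm_mat_in_carrier[OF that] by blast
      then show ?thesis
        using closure_subset by (auto simp: U_def)
    qed
    have aff: "\<exists>z. x = affine_pt z" if "x \<noteq> infinity_pt" for x
    proof -
      obtain t where t: "x = circle_pt t"
        using surj_circle_pt by (metis surjD)
      then have "x = affine_pt (cos t / sin t)"
        using that by (simp add: infinity_pt_iff affine_pt_iff)
      then show ?thesis ..
    qed
    have "open (affine_pt -` U)"
      using U continuous_on_affine_pt by (simp add: continuous_on_open_vimage)
    moreover have "affine_pt -` U \<noteq> {}"
    proof -
      obtain t where t: "circle_pt t \<in> U"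
        using U(2) surj_circle_pt by (metis ex_in_conv surjD)
      show ?thesis
      proof (cases "sin t = 0")
        case False
        then show ?thesis
          using t aff[of "circle_pt t"] by (auto simp: infinity_pt_iff)
      next
        case True
        have "open (circle_pt -` U)"
          using U(1) by (simp add: open_rp1_def)
        then obtain e where e: "e > 0" "ball t e \<subseteq> circle_pt -` U"
          using t by (meson open_contains_ball vimageI)
        \<comment> \<open>Infinity is not isolated: a turn by less than \<open>e\<close> stays in
          \<open>U\<close>, and one by less than \<open>pi\<close> leaves infinity.\<close>
        define u where "u = min (e / 2) 1"
        have u: "0 < u" "u < e" "u < pi"
          using e(1) pi_gt3 by (auto simp: u_def)
        have "circle_pt (t + u) \<in> U"
          using e(2) u by (auto simp: dist_real_def subset_iff)
        moreover have "sin (t + u) \<noteq> 0"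
          using True cos_sin_nonzero[of t] sin_gt_zero[of u] u by (simp add: sin_add)
        ultimately show ?thesis
          using aff[of "circle_pt (t + u)"] by (auto simp: infinity_pt_iff)
      qed
    qed
    ultimately obtain z e where z: "e > 0" "ball z e \<subseteq> affine_pt -` U"
      by (meson ex_in_conv open_contains_ball)
    obtain r where r: "r \<in> \<rat>" "z < r" "r < z + e"
      using Rats_dense_in_real[of z "z + e"] z(1) by auto
    then have rU: "affine_pt r \<in> U"
      using z by (auto simp: subset_iff dist_real_def)
    obtain p q :: int where pq: "q > 0" "coprime p q" "r = of_int p / of_int q"
      using r(1) by (rule Rats_cases')
    obtain u v where uv: "u * p + v * q = 1"
      using bezout_int[of p q] pq(2) by auto
    \<comment> \<open>The first column \<open>(p, q)\<close> sends infinity to \<open>r\<close>;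
      composing on the right with the translations by \<open>n\<close> gives the whole
      family.\<close>
    have det: "p * (q * n + u) - (p * n - v) * q = 1" for n
      using uv by (simp add: algebra_simps)
    show False
    proof (cases "x = infinity_pt")
      case True
      then show False
        using disj[OF det[of 0]] rU pq psl_act_infinity_pt[OF det[of 0]] by simp
    next
      case False
      then obtain y where y: "x = affine_pt y"
        using aff by blast
      define f where "f = (\<lambda>n::nat. (of_int p * y + (of_int p * real n - of_int v)) / (of_int q * y + (of_int q * real n + of_int u)))"
      have "f \<longlonglongrightarrow> of_int p * inverse (of_int q)"
        unfolding f_def using pq(1) by real_asymp
      then have "(\<lambda>n. affine_pt (f n)) \<longlonglongrightarrow> affine_pt r"
        unfolding pq(3) divide_inverse
        by (rule continuous_on_tendsto_compose[OF continuous_on_affine_pt]) simp_all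
      then have "\<forall>\<^sub>F n in sequentially. affine_pt (f n) \<in> U"
        using U(1) rU by (rule topological_tendstoD)
      moreover have "\<forall>\<^sub>F n in sequentially. of_int q * y + (of_int q * real n + of_int u) > 0"
        using pq(1) by real_asymp
      ultimately have "\<forall>\<^sub>F n in sequentially. False"
      proof eventually_elim
        case (elim n)
        have "psl_act (pm_mat p (p * int n - v) q (q * int n + u)) x = affine_pt (f n)"
          unfolding y psl_act_affine_pt[OF det] f_def using elim(2) by simp
        then show False
          using disj[OF det[of "int n"]] elim(1) by simp
      qed
      then show False by simp
    qed
  qed
qed

section \<open>Parabolic fixed points\<close>

lemma psl_act_lower_fixed_iff: "psl_act (pm_mat 1 0 1 1) (circle_pt t) = circle_pt t \<longleftrightarrow> cos t = 0"
  using psl_act_circle_pt_eq_iff[of 1 1 0 1 t] by (auto simp: algebra_simps)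

lemma psl_act_upper_fixed_iff: "psl_act (pm_mat 1 1 0 1) (circle_pt t) = circle_pt t \<longleftrightarrow> sin t = 0"
  using psl_act_circle_pt_eq_iff[of 1 1 1 0 t] by (auto simp: algebra_simps)

text \<open>One parabolic element serves both sides. Its only fixed point on the circle has lifts
  \<open>pi\<close> apart, so \<open>\<epsilon> = pi\<close> works.\<close>

lemma property_star_PSL2Z: "property_star PSL2Z psl_act"
  unfolding property_star_def
proof (intro conjI minimal_action_PSL2Z allI impI)
  fix \<theta>
  assume "circle_pt \<theta> \<in> NE PSL2Z psl_act"
  then obtain g where g: "g \<in> carrier PSL2Z" "psl_act g (circle_pt \<theta>) = circle_pt \<theta>"
      "\<And>t. psl_act g (circle_pt t) = circle_pt t \<Longrightarrow> sin (t - \<theta>) = 0"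
  proof -
    assume *: thesis if "g \<in> carrier PSL2Z" "psl_act g (circle_pt \<theta>) = circle_pt \<theta>"
      "\<And>t. psl_act g (circle_pt t) = circle_pt t \<Longrightarrow> sin (t - \<theta>) = 0" for g
    assume "circle_pt \<theta> \<in> NE PSL2Z psl_act"
    then consider "cos \<theta> = 0" | "sin \<theta> = 0"
      unfolding NE_PSL2Z_iff by blast
    then show thesis
    proof cases
      case 1
      show thesis
        by (rule *[of "pm_mat 1 0 1 1"]) (simp_all add: pm_mat_in_carrier psl_act_lower_fixed_iff 1 sin_diff)
    next
      case 2
      show thesis
        by (rule *[of "pm_mat 1 1 0 1"]) (simp_all add: pm_mat_in_carrier psl_act_upper_fixed_iff 2 sin_diff)
    qed
  qed
  have right: "sin (t - \<theta>) \<noteq> 0" if "t \<in> {\<theta><..<\<theta> + pi}" for t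
    using that sin_gt_zero[of "t - \<theta>"] by simp
  have left: "sin (t - \<theta>) \<noteq> 0" if "t \<in> {\<theta> - pi<..<\<theta>}" for t
    using that sin_gt_zero[of "\<theta> - t"] sin_minus[of "\<theta> - t"] by simp
  show "\<exists>gp\<in>carrier PSL2Z. \<exists>gm\<in>carrier PSL2Z.
      psl_act gp (circle_pt \<theta>) = circle_pt \<theta> \<and> psl_act gm (circle_pt \<theta>) = circle_pt \<theta> \<and>
      (\<exists>\<epsilon>>0. (\<forall>t\<in>{\<theta><..<\<theta> + \<epsilon>}. psl_act gp (circle_pt t) \<noteq> circle_pt t) \<and>
              (\<forall>t\<in>{\<theta> - \<epsilon><..<\<theta>}. psl_act gm (circle_pt t) \<noteq> circle_pt t))"
    using g left right pi_gt_zero by blast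
qed

theorem theorem3:
  shows "NE PSL2Z psl_act = {affine_pt 0, infinity_pt}
    \<and> (pm_mat 1 0 1 1 \<in> carrier PSL2Z
       \<and> (\<forall>x. x \<noteq> -1 \<longrightarrow> psl_act (pm_mat 1 0 1 1) (affine_pt x) = affine_pt (x / (x + 1)))
       \<and> isolated_fixed_point (psl_act (pm_mat 1 0 1 1)) (affine_pt 0))
    \<and> (pm_mat 1 1 0 1 \<in> carrier PSL2Z
       \<and> (\<forall>x. psl_act (pm_mat 1 1 0 1) (affine_pt x) = affine_pt (x + 1))
       \<and> isolated_fixed_point (psl_act (pm_mat 1 1 0 1)) infinity_pt)
    \<and> property_star PSL2Z psl_act
    \<and> (\<forall>F. finite F \<and> generates_semigroup PSL2Z F \<longrightarrow>
         (AE x in circle_lebesgue. lyapunov_exp PSL2Z psl_act F x = 0))"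
proof (intro conjI allI impI)
  have pt: "\<exists>t. x = circle_pt t" for x
    using surj_circle_pt by (metis surjD)
  have zero: "circle_pt t = affine_pt 0 \<longleftrightarrow> cos t = 0" for t
    by (simp add: affine_pt_iff)
  show "NE PSL2Z psl_act = {affine_pt 0, infinity_pt}"
  proof (rule Set.set_eqI)
    fix x
    show "x \<in> NE PSL2Z psl_act \<longleftrightarrow> x \<in> {affine_pt 0, infinity_pt}"
      using pt[of x] by (auto simp: NE_PSL2Z_iff zero infinity_pt_iff)
  qed
  show "pm_mat 1 0 1 1 \<in> carrier PSL2Z" "pm_mat 1 1 0 1 \<in> carrier PSL2Z"
    by (simp_all add: pm_mat_in_carrier)
  show "psl_act (pm_mat 1 0 1 1) (affine_pt x) = affine_pt (x / (x + 1))" if "x \<noteq> -1" for x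
    using psl_act_affine_pt[of 1 1 0 1 x] that by (auto simp: add_eq_0_iff)
  show "psl_act (pm_mat 1 1 0 1) (affine_pt x) = affine_pt (x + 1)" for x
    using psl_act_affine_pt[of 1 1 1 0 x] by simp
  have "psl_act (pm_mat 1 0 1 1) x = x \<longleftrightarrow> x = affine_pt 0" for x
    using pt[of x] psl_act_lower_fixed_iff zero by auto
  then show "isolated_fixed_point (psl_act (pm_mat 1 0 1 1)) (affine_pt 0)"
    \<comment> \<open>The fixed point is unique on the whole circle, so \<open>UNIV\<close> serves
      as the neighbourhood.\<close>
    unfolding isolated_fixed_point_def by (auto intro: exI[of _ UNIV])
  have "psl_act (pm_mat 1 1 0 1) x = x \<longleftrightarrow> x = infinity_pt" for x
    using pt[of x] psl_act_upper_fixed_iff infinity_pt_iff by auto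
  then show "isolated_fixed_point (psl_act (pm_mat 1 1 0 1)) infinity_pt"
    unfolding isolated_fixed_point_def by (auto intro: exI[of _ UNIV])
  show "property_star PSL2Z psl_act"
    by (rule property_star_PSL2Z)
  show "AE x in circle_lebesgue. lyapunov_exp PSL2Z psl_act F x = 0"
    if "finite F \<and> generates_semigroup PSL2Z F" for F
    using AE_slow by eventually_elim (use that lyapunov_exp_eq_0 in blast)
qed

end
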